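(* Let $\lambda\in\mathbb R$, $T>0$, and let $(\vec X^h(t),\kappa^h_g(t),\vec Y^h_g(t))\in\underline V^h\times V^h\times\underline V^h$, $t\in(0,T]$ (with $\vec X^h(0)\in\underline V^h$ given), be a solution of the semidiscrete scheme $(\mathcal Q_h)^\diamond$ defined in the context, with $\vec X^h$ and $\kappa^h_g$ differentiable in time and $\vec X^h$ taking values in $H$. Assume that $|\vec X^h_\rho|>0$ almost everywhere in $I\times(0,T)$. Then the solution satisfies $$\Bigl(g(\vec X^h)\,(\vec X^h_t\cdot\vec\omega^h)^2,\,|\vec X^h_\rho|_g\Bigr)^\diamond+\tfrac12\,\frac{\rm d}{{\rm d}t}\Bigl((\kappa^h_g)^2+2\lambda,\,|\vec X^h_\rho|_g\Bigr)^\diamond=0$$ at every $t\in(0,T)$ for which $|\vec X^h_\rho(\cdot,t)|>0$ on every element (hence for almost every $t\in(0,T)$).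
   Context: **Metric.** $H\subset\mathbb R^2$ is open and $g:H\to(0,\infty)$ is smooth. $\nabla\ln g$ and $D^2\ln g$ are the Euclidean gradient and Hessian of $\ln g$. Write $|\vec X^h_\rho|_g=g^{\frac12}(\vec X^h)\,|\vec X^h_\rho|$. **Rotation.** $\cdot^\perp$ is clockwise rotation by $\pi/2$ in $\mathbb R^2$: $(a_1,a_2)^\perp=(a_2,-a_1)$. **Finite elements.** $I=\mathbb R/\mathbb Z$ is the periodic unit interval, $J\ge3$, $h=1/J$, $q_j=jh$ for $j=0,\dots,J$, with $q_0=q_J$ identified, $I_j=[q_{j-1},q_j]$. $V^h$ is the space of continuous functions on $I$ that are affine on each $I_j$, and $\underline V^h=[V^h]^2$. **Inner products.** For piecewise continuous $u,v$ with possible jumps at the nodes, the mass-lumped product is $$(u,v)^h=\tfrac12 h\sum_{j=1}^J\bigl[(u\cdot v)(q_j^-)+(u\cdot v)(q_{j-1}^+)\bigr],$$ where $q^\pm$ denote one-sided limits. More generally $(u,v)^\diamond=I^\diamond(u\cdot v)$ with a fixed quadrature rule $$I^\diamond(f)=\sum_{j=1}^J h\sum_{k=1}^K w_k\,f(\alpha_kq_{j-1}+(1-\alpha_k)q_j),$$ where $K\ge2$, $w_k>0$, $\sum_{k=1}^Kw_k=1$, the $\alpha_k\in[0,1]$ are distinct, and values at end points of $I_j$ are understood as limits from inside $I_j$. **Discrete geometry.** For $\vec X^h(t)\in\underline V^h$ with $|\vec X^h_\rho|>0$ on each element: $\partial_s=|\vec X^h_\rho|^{-1}\partial_\rho$ (elementwise),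 $\vec\tau^h=\vec X^h_s$, $\vec\nu^h=-(\vec\tau^h)^\perp$ (elementwise constant), and $\vec\omega^h\in\underline V^h$ is defined by $(\vec\omega^h,\vec\varphi\,|\vec X^h_\rho|)^h=(\vec\nu^h,\vec\varphi\,|\vec X^h_\rho|)^h$ for all $\vec\varphi\in\underline V^h$. Subscript $t$ denotes the time derivative. **Scheme $(\mathcal Q_h)^\diamond$.** Given $\vec X^h(0)\in\underline V^h$, a solution is $(\vec X^h(t),\kappa^h_g(t),\vec Y^h_g(t))\in\underline V^h\times V^h\times\underline V^h$ such that for $t\in(0,T]$ (whenever the expressions are defined, i.e. $|\vec X^h_\rho(\cdot,t)|>0$ on every element) the following three equations hold. (i) For all $\vec\chi\in\underline V^h$: $$\begin{aligned} &\bigl(g(\vec X^h)\,\vec X^h_t\cdot\vec\omega^h,\ \vec\chi\cdot\vec\omega^h\,|\vec X^h_\rho|_g\bigr)^\diamond-\bigl((\vec Y^h_g)_s\cdot\vec\nu^h,\ \vec\chi_s\cdot\vec\nu^h\,|\vec X^h_\rho|_g\bigr)^\diamond\\ &\quad=-\tfrac12\bigl((\kappa^h_g)^2+2\lambda-\vec Y^h_g\cdot\nabla\ln g(\vec X^h),\ [\vec\chi_s\cdot\vec\tau^h+\tfrac12\vec\chi\cdot\nabla\ln g(\vec X^h)]\,|\vec X^h_\rho|_g\bigr)^\diamond\\ &\qquad+\tfrac12\bigl((D^2\ln g(\vec X^h))\,\vec Y^h_g,\ \vec\chi\,|\vec X^h_\rho|_g\bigr)^\diamond+\bigl(g^{\frac12}(\vec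 X^h)\,\kappa^h_g,\ \vec\chi_s\cdot(\vec Y^h_g)^\perp\,|\vec X^h_\rho|_g\bigr)^\diamond\\ &\qquad+\bigl(g^{\frac12}(\vec X^h)\,\kappa^h_g\,\vec Y^h_g\cdot\vec\nu^h+\tfrac12(\vec Y^h_g)_s\cdot\vec\tau^h,\ \vec\chi\cdot\nabla\ln g(\vec X^h)\,|\vec X^h_\rho|_g\bigr)^\diamond . \end{aligned}$$ (ii) For all $\chi\in V^h$: $\ \bigl(\kappa^h_g-g^{\frac12}(\vec X^h)\,\vec Y^h_g\cdot\vec\nu^h,\ \chi\,|\vec X^h_\rho|_g\bigr)^\diamond=0$. (iii) For all $\vec\eta\in\underline V^h$: $$\bigl(g^{\frac12}(\vec X^h)\,\kappa^h_g\,\vec\nu^h,\ \vec\eta\,|\vec X^h_\rho|_g\bigr)^\diamond+\bigl(\vec X^h_s,\ \vec\eta_s\,|\vec X^h_\rho|_g\bigr)^\diamond+\tfrac12\bigl(\nabla\ln g(\vec X^h),\ \vec\eta\,|\vec X^h_\rho|_g\bigr)^\diamond=0 .$$ *)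

theory Defs
  imports "HOL-Analysis.Analysis"
begin

section \<open>Smooth functions, gradient and Hessian\<close>

primrec Ck_on :: "nat \<Rightarrow> ('a::real_normed_vector \<Rightarrow> 'b::real_normed_vector) \<Rightarrow> 'a set \<Rightarrow> bool" where
  "Ck_on 0 f S \<longleftrightarrow> continuous_on S f"
| "Ck_on (Suc k) f S \<longleftrightarrow> (\<forall>x\<in>S. f differentiable (at x)) \<and>
     (\<forall>v. Ck_on k (\<lambda>x. frechet_derivative f (at x) v) S)"

text \<open>Used on open sets only.\<close>

definition smooth_on :: "('a::real_normed_vector \<Rightarrow> 'b::real_normed_vector) \<Rightarrow> 'a set \<Rightarrow> bool" where
  "smooth_on f S \<longleftrightarrow> (\<forall>k. Ck_on k f S)"

definition grad :: "(real^2 \<Rightarrow> real) \<Rightarrow> real^2 \<Rightarrow> real^2" where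
  "grad f x = (THE D. GDERIV f x :> D)"

definition hessian :: "(real^2 \<Rightarrow> real) \<Rightarrow> real^2 \<Rightarrow> real^2^2" where
  "hessian f x = jacobian (grad f) (at x)"

definition perp :: "real^2 \<Rightarrow> real^2" where
  "perp a = vector [a $ 2, - (a $ 1)]"


section \<open>Finite element spaces\<close>

text \<open>
  Functions on the periodic unit interval are represented by 1-periodic functions on the
  real line, so the element between \<open>node J (j - 1)\<close> and \<open>node J j\<close> (for \<open>j = 1, \<dots>, J\<close>)
  is an ordinary interval and the nodes with indices \<open>0\<close> and \<open>J\<close> are identified.
\<close>

definition node :: "nat \<Rightarrow> nat \<Rightarrow> real" where
  "node J j = real j / real J"

definition element :: "nat \<Rightarrow> nat \<Rightarrow> real set" where
  "element J j = {node J (j - 1)..node J j}"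

definition Vh :: "nat \<Rightarrow> (real \<Rightarrow> real) set" where
  "Vh J = {u. (\<forall>r. u (r + 1) = u r) \<and> continuous_on UNIV u \<and>
              (\<forall>j\<in>{1..J}. \<exists>a b. \<forall>r\<in>element J j. u r = a + b * r)}"

definition VVh :: "nat \<Rightarrow> (real \<Rightarrow> real^2) set" where
  "VVh J = {u. \<forall>i. (\<lambda>r. u r $ i) \<in> Vh J}"


section \<open>Inner products\<close>

text \<open>The value of a piecewise continuous \<open>f\<close> at a point \<open>r\<close> of the element with end points
  \<open>a < b\<close>; at the end points it is the limit from inside the element.\<close>

definition value_in :: "real \<Rightarrow> real \<Rightarrow> (real \<Rightarrow> real) \<Rightarrow> real \<Rightarrow> real" where
  "value_in a b f r =
     (if r = a then Lim (at_right a) f else if r = b then Lim (at_left b) f else f r)"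

definition lumped_ip :: "nat \<Rightarrow> (real \<Rightarrow> 'v::real_inner) \<Rightarrow> (real \<Rightarrow> 'v) \<Rightarrow> real" where
  "lumped_ip J u v = 1/2 * (1 / real J) *
     (\<Sum>j=1..J. Lim (at_left (node J j)) (\<lambda>r. u r \<bullet> v r) +
                Lim (at_right (node J (j - 1))) (\<lambda>r. u r \<bullet> v r))"

definition quad :: "nat \<Rightarrow> nat \<Rightarrow> (nat \<Rightarrow> real) \<Rightarrow> (nat \<Rightarrow> real) \<Rightarrow> (real \<Rightarrow> real) \<Rightarrow> real" where
  "quad J K w \<alpha> f = (\<Sum>j=1..J. (1 / real J) *
     (\<Sum>k=1..K. w k * value_in (node J (j - 1)) (node J j) f
                         (\<alpha> k * node J (j - 1) + (1 - \<alpha> k) * node J j)))"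

definition quad_ip ::
    "nat \<Rightarrow> nat \<Rightarrow> (nat \<Rightarrow> real) \<Rightarrow> (nat \<Rightarrow> real) \<Rightarrow> (real \<Rightarrow> 'v::real_inner) \<Rightarrow> (real \<Rightarrow> 'v) \<Rightarrow> real" where
  "quad_ip J K w \<alpha> u v = quad J K w \<alpha> (\<lambda>r. u r \<bullet> v r)"

definition quadrature_rule :: "nat \<Rightarrow> (nat \<Rightarrow> real) \<Rightarrow> (nat \<Rightarrow> real) \<Rightarrow> bool" where
  "quadrature_rule K w \<alpha> \<longleftrightarrow> K \<ge> 2 \<and> (\<forall>k\<in>{1..K}. w k > 0) \<and> (\<Sum>k=1..K. w k) = 1 \<and>
     (\<forall>k\<in>{1..K}. 0 \<le> \<alpha> k \<and> \<alpha> k \<le> 1) \<and> inj_on \<alpha> {1..K}"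


section \<open>Discrete geometry\<close>

text \<open>For elements of the finite element spaces the derivative \<open>d\<rho>\<close>, and with it every quantity
  below except \<open>omega\<close>, is meaningful only in the interior of the elements; \<^const>\<open>lumped_ip\<close> and
  \<^const>\<open>quad_ip\<close> do not see the values at the nodes.\<close>

definition d\<rho> :: "(real \<Rightarrow> 'v::real_normed_vector) \<Rightarrow> real \<Rightarrow> 'v" where
  "d\<rho> u r = vector_derivative u (at r)"

definition len :: "(real \<Rightarrow> real^2) \<Rightarrow> real \<Rightarrow> real" where
  "len X r = norm (d\<rho> X r)"

definition len_g :: "(real^2 \<Rightarrow> real) \<Rightarrow> (real \<Rightarrow> real^2) \<Rightarrow> real \<Rightarrow> real" where
  "len_g g X r = sqrt (g (X r)) * len X r"

definition ds :: "(real \<Rightarrow> real^2) \<Rightarrow> (real \<Rightarrow> 'v::real_normed_vector) \<Rightarrow> real \<Rightarrow> 'v" where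
  "ds X u r = inverse (len X r) *\<^sub>R d\<rho> u r"

definition tau :: "(real \<Rightarrow> real^2) \<Rightarrow> real \<Rightarrow> real^2" where
  "tau X r = ds X X r"

definition nu :: "(real \<Rightarrow> real^2) \<Rightarrow> real \<Rightarrow> real^2" where
  "nu X r = - perp (tau X r)"

definition omega :: "nat \<Rightarrow> (real \<Rightarrow> real^2) \<Rightarrow> real \<Rightarrow> real^2" where
  "omega J X = (THE om. om \<in> VVh J \<and>
     (\<forall>\<phi>\<in>VVh J. lumped_ip J om (\<lambda>r. len X r *\<^sub>R \<phi> r) = lumped_ip J (nu X) (\<lambda>r. len X r *\<^sub>R \<phi> r)))"

definition nondegenerate :: "nat \<Rightarrow> (real \<Rightarrow> real^2) \<Rightarrow> bool" where
  "nondegenerate J X \<longleftrightarrow> (\<forall>j\<in>{1..J}. \<forall>r\<in>interior (element J j). len X r > 0)"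


section \<open>The semidiscrete scheme\<close>

text \<open>\<open>X\<close>, \<open>Xt\<close>, \<open>\<kappa>\<close>, \<open>Y\<close> are the values, at a fixed time, of the position, its time derivative,
  the discrete geodesic curvature and the auxiliary vector variable.\<close>

definition scheme_i ::
    "nat \<Rightarrow> nat \<Rightarrow> (nat \<Rightarrow> real) \<Rightarrow> (nat \<Rightarrow> real) \<Rightarrow> (real^2 \<Rightarrow> real) \<Rightarrow> real \<Rightarrow>
     (real \<Rightarrow> real^2) \<Rightarrow> (real \<Rightarrow> real^2) \<Rightarrow> (real \<Rightarrow> real) \<Rightarrow> (real \<Rightarrow> real^2) \<Rightarrow> bool" where
  "scheme_i J K w \<alpha> g lam X Xt \<kappa> Y \<longleftrightarrow>
    (let G = (\<lambda>r. grad (\<lambda>x. ln (g x)) (X r));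
         D2 = (\<lambda>r. hessian (\<lambda>x. ln (g x)) (X r));
         \<tau> = tau X; \<nu> = nu X; \<omega> = omega J X; l = len_g g X
     in \<forall>chi\<in>VVh J.
       quad_ip J K w \<alpha> (\<lambda>r. g (X r) * (Xt r \<bullet> \<omega> r)) (\<lambda>r. (chi r \<bullet> \<omega> r) * l r)
       - quad_ip J K w \<alpha> (\<lambda>r. ds X Y r \<bullet> \<nu> r) (\<lambda>r. (ds X chi r \<bullet> \<nu> r) * l r)
       = - (1/2) * quad_ip J K w \<alpha> (\<lambda>r. (\<kappa> r)\<^sup>2 + 2 * lam - Y r \<bullet> G r)
                                   (\<lambda>r. (ds X chi r \<bullet> \<tau> r + 1/2 * (chi r \<bullet> G r)) * l r)
         + 1/2 * quad_ip J K w \<alpha> (\<lambda>r. D2 r *v Y r) (\<lambda>r. l r *\<^sub>R chi r)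
         + quad_ip J K w \<alpha> (\<lambda>r. sqrt (g (X r)) * \<kappa> r) (\<lambda>r. (ds X chi r \<bullet> perp (Y r)) * l r)
         + quad_ip J K w \<alpha> (\<lambda>r. sqrt (g (X r)) * \<kappa> r * (Y r \<bullet> \<nu> r) + 1/2 * (ds X Y r \<bullet> \<tau> r))
                           (\<lambda>r. (chi r \<bullet> G r) * l r))"

definition scheme_ii ::
    "nat \<Rightarrow> nat \<Rightarrow> (nat \<Rightarrow> real) \<Rightarrow> (nat \<Rightarrow> real) \<Rightarrow> (real^2 \<Rightarrow> real) \<Rightarrow>
     (real \<Rightarrow> real^2) \<Rightarrow> (real \<Rightarrow> real) \<Rightarrow> (real \<Rightarrow> real^2) \<Rightarrow> bool" where
  "scheme_ii J K w \<alpha> g X \<kappa> Y \<longleftrightarrow> (\<forall>chi\<in>Vh J.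
     quad_ip J K w \<alpha> (\<lambda>r. \<kappa> r - sqrt (g (X r)) * (Y r \<bullet> nu X r)) (\<lambda>r. chi r * len_g g X r) = 0)"

definition scheme_iii ::
    "nat \<Rightarrow> nat \<Rightarrow> (nat \<Rightarrow> real) \<Rightarrow> (nat \<Rightarrow> real) \<Rightarrow> (real^2 \<Rightarrow> real) \<Rightarrow>
     (real \<Rightarrow> real^2) \<Rightarrow> (real \<Rightarrow> real) \<Rightarrow> bool" where
  "scheme_iii J K w \<alpha> g X \<kappa> \<longleftrightarrow> (\<forall>eta\<in>VVh J.
     quad_ip J K w \<alpha> (\<lambda>r. (sqrt (g (X r)) * \<kappa> r) *\<^sub>R nu X r) (\<lambda>r. len_g g X r *\<^sub>R eta r)
     + quad_ip J K w \<alpha> (ds X X) (\<lambda>r. len_g g X r *\<^sub>R ds X eta r)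
     + 1/2 * quad_ip J K w \<alpha> (\<lambda>r. grad (\<lambda>x. ln (g x)) (X r)) (\<lambda>r. len_g g X r *\<^sub>R eta r) = 0)"

text \<open>Time-dependent functions take the time as first argument. The time derivative is taken
  relative to \<open>(0, T]\<close>, so it is two-sided for \<open>t < T\<close> and one-sided at \<open>t = T\<close>.\<close>

definition dt :: "real \<Rightarrow> (real \<Rightarrow> real \<Rightarrow> 'v::real_normed_vector) \<Rightarrow> real \<Rightarrow> real \<Rightarrow> 'v" where
  "dt T u t r = vector_derivative (\<lambda>s. u s r) (at t within {0<..T})"

definition differentiable_in_time ::
    "real \<Rightarrow> (real \<Rightarrow> real \<Rightarrow> 'v::real_normed_vector) \<Rightarrow> bool" where
  "differentiable_in_time T u \<longleftrightarrow>
     (\<forall>t\<in>{0<..T}. \<forall>r. (\<lambda>s. u s r) differentiable (at t within {0<..T}))"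

definition scheme_solution ::
    "nat \<Rightarrow> nat \<Rightarrow> (nat \<Rightarrow> real) \<Rightarrow> (nat \<Rightarrow> real) \<Rightarrow> (real^2 \<Rightarrow> real) \<Rightarrow> real \<Rightarrow> real \<Rightarrow>
     (real \<Rightarrow> real \<Rightarrow> real^2) \<Rightarrow> (real \<Rightarrow> real \<Rightarrow> real) \<Rightarrow> (real \<Rightarrow> real \<Rightarrow> real^2) \<Rightarrow> bool" where
  "scheme_solution J K w \<alpha> g lam T X \<kappa> Y \<longleftrightarrow>
     X 0 \<in> VVh J \<and>
     (\<forall>t\<in>{0<..T}. X t \<in> VVh J \<and> \<kappa> t \<in> Vh J \<and> Y t \<in> VVh J \<and>
        (nondegenerate J (X t) \<longrightarrow>
           scheme_i J K w \<alpha> g lam (X t) (dt T X t) (\<kappa> t) (Y t) \<and>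
           scheme_ii J K w \<alpha> g (X t) (\<kappa> t) (Y t) \<and>
           scheme_iii J K w \<alpha> g (X t) (\<kappa> t)))"

definition energy ::
    "nat \<Rightarrow> nat \<Rightarrow> (nat \<Rightarrow> real) \<Rightarrow> (nat \<Rightarrow> real) \<Rightarrow> (real^2 \<Rightarrow> real) \<Rightarrow> real \<Rightarrow>
     (real \<Rightarrow> real^2) \<Rightarrow> (real \<Rightarrow> real) \<Rightarrow> real" where
  "energy J K w \<alpha> g lam X \<kappa> = quad_ip J K w \<alpha> (\<lambda>r. (\<kappa> r)\<^sup>2 + 2 * lam) (len_g g X)"

text \<open>The energy identity at time \<open>t\<close>, including the existence of the time derivative in it.\<close>

definition energy_identity ::
    "nat \<Rightarrow> nat \<Rightarrow> (nat \<Rightarrow> real) \<Rightarrow> (nat \<Rightarrow> real) \<Rightarrow> (real^2 \<Rightarrow> real) \<Rightarrow> real \<Rightarrow> real \<Rightarrow>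
     (real \<Rightarrow> real \<Rightarrow> real^2) \<Rightarrow> (real \<Rightarrow> real \<Rightarrow> real) \<Rightarrow> real \<Rightarrow> bool" where
  "energy_identity J K w \<alpha> g lam T X \<kappa> t \<longleftrightarrow>
     (\<lambda>s. energy J K w \<alpha> g lam (X s) (\<kappa> s)) field_differentiable (at t) \<and>
     quad_ip J K w \<alpha> (\<lambda>r. g (X t r) * (dt T X t r \<bullet> omega J (X t) r)\<^sup>2) (len_g g (X t))
     + 1/2 * deriv (\<lambda>s. energy J K w \<alpha> g lam (X s) (\<kappa> s)) t = 0"

end

theory Submission
  imports Defs
begin

text \<open>
  At a nondegenerate time, differentiate scheme (iii) in time with the test function fixed at the
  current \<open>Y\<close>; this is legitimate because nondegeneracy is an open condition in time. Together with
  scheme (i) tested with \<open>X\<^sub>t\<close> and scheme (ii) tested with \<open>\<kappa>\<^sub>t\<close> this yields the energy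
  identity already pointwise at each quadrature node, so no property of the quadrature beyond linearity
  is needed. The pointwise identity rests on the symmetry of the Hessian of \<open>ln g\<close> and on the
  decomposition of \<open>(X\<^sub>t)\<^sub>s \<bullet> Y\<^sub>s\<close> into its tangential and normal parts. Since \<open>X\<close> is
  affine on each element, being nondegenerate for almost every parameter is the same as being
  nondegenerate on every element, and Fubini gives the almost-everywhere statement.
\<close>

subsection \<open>Symmetry of second derivatives\<close>

text \<open>The mean value theorem is applied twice: along \<open>u\<close> to the difference of
  \<open>f\<close> on two opposite sides of the parallelogram, then along \<open>v\<close> to the
  directional derivative in direction \<open>u\<close>. The bound on \<open>h\<close> keeps the
  whole parallelogram inside the ball.\<close>

lemma second_difference_mean_value:
  fixes f :: "'a::real_normed_vector \<Rightarrow> real"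
  assumes f: "\<And>y. y \<in> ball x d \<Longrightarrow> f differentiable (at y)"
    and fu: "\<And>y. y \<in> ball x d \<Longrightarrow> (\<lambda>y. frechet_derivative f (at y) u) differentiable (at y)"
    and h: "h > 0" "h * (norm u + norm v) < d"
  shows "\<exists>y. norm (y - x) \<le> h * (norm u + norm v) \<and>
    f (x + h *\<^sub>R u + h *\<^sub>R v) - f (x + h *\<^sub>R u) - f (x + h *\<^sub>R v) + f x =
    h * h * frechet_derivative (\<lambda>y. frechet_derivative f (at y) u) (at y) v"
proof -
  have norm_le: "norm (s *\<^sub>R u + r *\<^sub>R v) \<le> h * (norm u + norm v)"
    if "0 \<le> s" "s \<le> h" "0 \<le> r" "r \<le> h" for s r
  proof -
    have "norm (s *\<^sub>R u + r *\<^sub>R v) \<le> s * norm u + r * norm v"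
      using norm_triangle_ineq[of "s *\<^sub>R u" "r *\<^sub>R v"] that by simp
    also have "\<dots> \<le> h * norm u + h * norm v"
      using that by (intro add_mono mult_right_mono) auto
    finally show ?thesis by (simp add: algebra_simps)
  qed
  have ball: "x + s *\<^sub>R u + r *\<^sub>R v \<in> ball x d" if "0 \<le> s" "s \<le> h" "0 \<le> r" "r \<le> h" for s r
  proof -
    have "dist x (x + s *\<^sub>R u + r *\<^sub>R v) = norm (s *\<^sub>R u + r *\<^sub>R v)"
      by (metis add.assoc add_diff_cancel_left' dist_commute dist_norm)
    with norm_le[OF that] h(2) show ?thesis by simp
  qed
  have line: "((\<lambda>s. k (a + s *\<^sub>R b)) has_real_derivative frechet_derivative k (at (a + s *\<^sub>R b)) b) (at s)"
    if "k differentiable (at (a + s *\<^sub>R b))" for k :: "'a \<Rightarrow> real" and a b s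
  proof -
    have "(k has_derivative frechet_derivative k (at (a + s *\<^sub>R b))) (at (a + s *\<^sub>R b))"
      using that by (simp add: frechet_derivative_works)
    then have "((\<lambda>s. k (a + s *\<^sub>R b)) has_derivative
        (\<lambda>c. frechet_derivative k (at (a + s *\<^sub>R b)) (c *\<^sub>R b))) (at s)"
      by (rule has_derivative_compose[rotated]) (auto intro!: derivative_eq_intros)
    moreover have "(\<lambda>c. frechet_derivative k (at (a + s *\<^sub>R b)) (c *\<^sub>R b)) =
        (*) (frechet_derivative k (at (a + s *\<^sub>R b)) b)"
      using linear_frechet_derivative[OF that] by (auto simp: linear_cmul mult.commute)
    ultimately show ?thesis by (simp add: has_field_derivative_def)
  qed
  \<comment> \<open>Taking the difference in direction \<open>v\<close> first makes the second
    difference an increment of a function of one variable.\<close>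
  define \<psi> where "\<psi> s = f (x + h *\<^sub>R v + s *\<^sub>R u) - f (x + s *\<^sub>R u)" for s
  have "DERIV \<psi> s :> frechet_derivative f (at (x + h *\<^sub>R v + s *\<^sub>R u)) u
      - frechet_derivative f (at (x + s *\<^sub>R u)) u" if "0 \<le> s" "s \<le> h" for s
    unfolding \<psi>_def using ball[of s h] ball[of s 0] that h(1)
    by (intro DERIV_diff line f) (auto simp: algebra_simps)
  from MVT2[OF h(1) this] obtain s where s: "0 < s" "s < h" and
    \<psi>: "\<psi> h - \<psi> 0 = h * (frechet_derivative f (at (x + h *\<^sub>R v + s *\<^sub>R u)) u
      - frechet_derivative f (at (x + s *\<^sub>R u)) u)" by auto
  define \<xi> where "\<xi> r = frechet_derivative f (at (x + s *\<^sub>R u + r *\<^sub>R v)) u" for r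
  have "DERIV \<xi> r :> frechet_derivative (\<lambda>y. frechet_derivative f (at y) u) (at (x + s *\<^sub>R u + r *\<^sub>R v)) v"
    if "0 \<le> r" "r \<le> h" for r
    unfolding \<xi>_def using ball[of s r] that s
    by (intro line[where k = "\<lambda>y. frechet_derivative f (at y) u"] fu) auto
  from MVT2[OF h(1) this] obtain r where r: "0 < r" "r < h" and
    \<xi>: "\<xi> h - \<xi> 0 = h * frechet_derivative (\<lambda>y. frechet_derivative f (at y) u) (at (x + s *\<^sub>R u + r *\<^sub>R v)) v"
    by auto
  have "\<psi> h - \<psi> 0 = h * (\<xi> h - \<xi> 0)"
    unfolding \<psi> \<xi>_def by (simp add: algebra_simps)
  then have "\<psi> h - \<psi> 0 = h * h * frechet_derivative (\<lambda>y. frechet_derivative f (at y) u) (at (x + s *\<^sub>R u + r *\<^sub>R v)) v"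
    unfolding \<xi> by simp
  moreover have "\<psi> h - \<psi> 0 = f (x + h *\<^sub>R u + h *\<^sub>R v) - f (x + h *\<^sub>R u) - f (x + h *\<^sub>R v) + f x"
    unfolding \<psi>_def by (simp add: algebra_simps)
  moreover have "norm ((x + s *\<^sub>R u + r *\<^sub>R v) - x) \<le> h * (norm u + norm v)"
    using norm_le[of s r] s r by (simp add: add.assoc)
  ultimately show ?thesis by metis
qed

text \<open>The second difference does not change when \<open>u\<close> and \<open>v\<close> are
  exchanged, so the mean value lemma represents it by either mixed derivative, each at some point
  near \<open>x\<close>. Continuity of both mixed derivatives at \<open>x\<close> removes the
  difference between these points.\<close>

theorem second_derivative_symmetric:
  fixes f :: "'a::real_normed_vector \<Rightarrow> real"
  assumes S: "open S" "x \<in> S" and C2: "Ck_on 2 f S"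
  shows "frechet_derivative (\<lambda>y. frechet_derivative f (at y) u) (at x) v =
         frechet_derivative (\<lambda>y. frechet_derivative f (at y) v) (at x) u"
proof -
  define M where "M u v y = frechet_derivative (\<lambda>y. frechet_derivative f (at y) u) (at y) v" for u v y
  have f: "f differentiable (at y)" if "y \<in> S" for y
    using C2 that by (simp add: numeral_2_eq_2)
  have fu: "(\<lambda>y. frechet_derivative f (at y) u) differentiable (at y)" if "y \<in> S" for y u
    using C2 that by (simp add: numeral_2_eq_2)
  have cont: "isCont (M u v) x" for u v
    using C2 S by (simp add: numeral_2_eq_2 M_def[abs_def] continuous_on_eq_continuous_at)
  have "\<bar>M u v x - M v u x\<bar> \<le> e" if "e > 0" for e
  proof -
    obtain d0 where d0: "d0 > 0" "ball x d0 \<subseteq> S" using S by (meson openE)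
    have "\<forall>\<^sub>F y in nhds x. dist (M u v y) (M u v x) < e/2" for u v
      using cont[of u v, unfolded isCont_def tendsto_at_iff_tendsto_nhds] that
      by (intro tendstoD) auto
    from eventually_conj[OF this[of u v] this[of v u]]
    obtain d1 where d1: "d1 > 0" and
      near: "dist y x < d1 \<Longrightarrow> dist (M u v y) (M u v x) < e/2 \<and> dist (M v u y) (M v u x) < e/2" for y
      unfolding eventually_nhds_metric by metis
    define d where "d = min d0 d1"
    \<comment> \<open>This gives \<open>h * (norm u + norm v) \<le> d / 2\<close>; the summand 1
      keeps the denominator positive when \<open>u\<close> and \<open>v\<close> both vanish.\<close>
    define h where "h = d / (2 * (norm u + norm v + 1))"
    have d: "d > 0" "ball x d \<subseteq> S" using d0 d1 by (auto simp: d_def)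
    have pos: "norm u + norm v + 1 > 0" using norm_ge_zero[of u] norm_ge_zero[of v] by linarith
    have h: "h > 0" using d pos by (simp add: h_def)
    have "h * (norm u + norm v) \<le> h * (norm u + norm v + 1)" using h by (intro mult_left_mono) auto
    also have "\<dots> = d / 2" using pos by (simp add: h_def field_simps)
    finally have hd: "h * (norm u + norm v) < d" using d by simp
    have mv: "\<exists>y. norm (y - x) \<le> h * (norm u + norm v) \<and>
        f (x + h *\<^sub>R u + h *\<^sub>R v) - f (x + h *\<^sub>R u) - f (x + h *\<^sub>R v) + f x = h * h * M u v y"
      if "h * (norm u + norm v) < d" for u v
      unfolding M_def
    proof (rule second_difference_mean_value[where d = d])
      show "f differentiable (at y)" if "y \<in> ball x d" for y
        using f that d(2) by blast
      show "(\<lambda>y. frechet_derivative f (at y) u) differentiable (at y)" if "y \<in> ball x d" for y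
        using fu[of y u] that d(2) by blast
    qed (use h that in auto)
    obtain y where y: "norm (y - x) \<le> h * (norm u + norm v)"
      "f (x + h *\<^sub>R u + h *\<^sub>R v) - f (x + h *\<^sub>R u) - f (x + h *\<^sub>R v) + f x = h * h * M u v y"
      using mv[OF hd] by auto
    obtain z where z: "norm (z - x) \<le> h * (norm u + norm v)"
      "f (x + h *\<^sub>R v + h *\<^sub>R u) - f (x + h *\<^sub>R v) - f (x + h *\<^sub>R u) + f x = h * h * M v u z"
      using mv[of v u] hd unfolding add.commute[of "norm v"] by auto
    have "h * h * M u v y = h * h * M v u z"
      using y(2) z(2) by (simp add: algebra_simps)
    then have "M u v y = M v u z" using h by simp
    moreover have "dist y x < d1" "dist z x < d1"
      using y(1) z(1) hd unfolding dist_norm d_def by simp_all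
    ultimately show ?thesis using near[of y] near[of z] unfolding dist_real_def by linarith
  qed
  then have "\<bar>M u v x - M v u x\<bar> \<le> 0" by (rule field_le_epsilon) simp
  then have "M u v x = M v u x" by simp
  then show ?thesis unfolding M_def .
qed

subsection \<open>Gradient and Hessian of the logarithm of the metric\<close>

text \<open>Uniqueness of the Frechet derivative makes the definite description in
  \<open>grad\<close> well defined.\<close>

lemma grad_eq: "GDERIV f x :> D \<Longrightarrow> grad f x = D"
proof -
  assume D: "GDERIV f x :> D"
  have "E = D" if "GDERIV f x :> E" for E
  proof -
    have "(\<lambda>h. h \<bullet> E) = (\<lambda>h. h \<bullet> D)"
      by (rule has_derivative_unique[OF that[unfolded gderiv_def] D[unfolded gderiv_def]])
    from fun_cong[OF this] show ?thesis using vector_eq_ldot by blast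
  qed
  with D show ?thesis unfolding grad_def by blast
qed

locale metric =
  fixes H :: "(real^2) set" and g :: "real^2 \<Rightarrow> real"
  assumes open_H: "open H" and g_pos: "\<And>x. x \<in> H \<Longrightarrow> g x > 0" and smooth_g: "smooth_on g H"
begin

abbreviation "G \<equiv> grad (\<lambda>x. ln (g x))"
abbreviation "D2 \<equiv> hessian (\<lambda>x. ln (g x))"

context
begin

text \<open>\<open>D\<close> and \<open>L\<close> are the directional derivatives of
  \<open>g\<close> and of \<open>ln g\<close>, and \<open>M u v\<close> is the derivative of
  \<open>L u\<close> in direction \<open>v\<close> by the quotient rule. Everything is reduced to
  derivatives of \<open>g\<close>, whose smoothness is what is assumed.\<close>

private definition "D v x = frechet_derivative g (at x) v"
private definition "L v x = D v x / g x"
private definition "M u v x = frechet_derivative (D u) (at x) v / g x - D u x * D v x / (g x)\<^sup>2"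

private lemma smooth_facts:
  "x \<in> H \<Longrightarrow> (g has_derivative (\<lambda>v. D v x)) (at x)"
  "x \<in> H \<Longrightarrow> (D u has_derivative frechet_derivative (D u) (at x)) (at x)"
  "continuous_on H (\<lambda>x. frechet_derivative (D u) (at x) v)"
  "x \<in> H \<Longrightarrow> frechet_derivative (D u) (at x) v = frechet_derivative (D v) (at x) u"
proof -
  have C2: "Ck_on 2 g H" using smooth_g by (simp add: smooth_on_def)
  show "x \<in> H \<Longrightarrow> (g has_derivative (\<lambda>v. D v x)) (at x)"
    "x \<in> H \<Longrightarrow> (D u has_derivative frechet_derivative (D u) (at x)) (at x)"
    "continuous_on H (\<lambda>x. frechet_derivative (D u) (at x) v)"
    using C2 by (auto simp: numeral_2_eq_2 D_def[abs_def] frechet_derivative_works)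
  show "x \<in> H \<Longrightarrow> frechet_derivative (D u) (at x) v = frechet_derivative (D v) (at x) u"
    using second_derivative_symmetric[OF open_H _ C2] by (simp add: D_def[abs_def])
qed

private lemma L_deriv: "x \<in> H \<Longrightarrow> (L u has_derivative (\<lambda>v. M u v x)) (at x)"
  unfolding L_def[abs_def] M_def
  using g_pos[of x] by (auto intro!: derivative_eq_intros smooth_facts(1,2) simp: field_simps power2_eq_square)

private lemma ln_gderiv: "x \<in> H \<Longrightarrow> GDERIV (\<lambda>x. ln (g x)) x :> (\<chi> i. L (axis i 1) x)"
proof -
  assume x: "x \<in> H"
  have lin: "linear (\<lambda>v. D v x)" using smooth_facts(1)[OF x] by (rule has_derivative_linear)
  have eq: "(\<lambda>h. h \<bullet> (\<chi> i. L (axis i 1) x)) = (\<lambda>h. L h x)"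
  proof
    fix h
    have "D h x = D (\<Sum>i\<in>UNIV. h $ i *\<^sub>R axis i 1) x"
      using basis_expansion[of h] by (simp add: scalar_mult_eq_scaleR)
    also have "\<dots> = (\<Sum>i\<in>UNIV. h $ i * D (axis i 1) x)"
      by (simp add: linear_sum[OF lin] linear_cmul[OF lin])
    finally show "h \<bullet> (\<chi> i. L (axis i 1) x) = L h x"
      by (simp add: L_def inner_vec_def sum_divide_distrib)
  qed
  have "((\<lambda>x. ln (g x)) has_derivative (\<lambda>h. L h x)) (at x)"
    unfolding L_def using g_pos[OF x] x
    by (auto intro!: derivative_eq_intros smooth_facts(1,2) simp: field_simps)
  then show ?thesis unfolding gderiv_def eq .
qed

lemma GDERIV_ln: "x \<in> H \<Longrightarrow> GDERIV (\<lambda>x. ln (g x)) x :> G x"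
  using ln_gderiv grad_eq by metis

text \<open>The gradient of \<open>ln g\<close> is that of \<open>g\<close> divided by
  \<open>g\<close>. In this form every derivative of the metric along a curve is expressed through
  \<open>G\<close>.\<close>

lemma g_deriv:
  assumes "x \<in> H"
  shows "(g has_derivative (\<lambda>v. g x * (v \<bullet> G x))) (at x)"
proof -
  have "((\<lambda>x. ln (g x)) has_derivative (\<lambda>h. L h x)) (at x)"
    unfolding L_def using g_pos[OF assms] assms
    by (auto intro!: derivative_eq_intros smooth_facts(1,2) simp: field_simps)
  then have "(\<lambda>v. v \<bullet> G x) = (\<lambda>h. L h x)"
    using GDERIV_ln[OF assms] unfolding gderiv_def by (rule has_derivative_unique[rotated])
  from fun_cong[OF this] have "(\<lambda>v. g x * (v \<bullet> G x)) = (\<lambda>v. D v x)"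
    using g_pos[OF assms] by (auto simp: L_def field_simps)
  then show ?thesis using smooth_facts(1)[OF assms] by simp
qed

text \<open>The components of \<open>G\<close> agree on \<open>H\<close> with
  \<open>L (axis i 1)\<close> and are therefore differentiable; \<open>hessian\<close> is the
  Jacobian of \<open>grad\<close> and so represents the derivative.\<close>

lemma G_deriv:
  assumes "x \<in> H"
  shows "(G has_derivative (*v) (D2 x)) (at x)"
proof -
  have "((\<lambda>x. \<chi> i. L (axis i 1) x) has_derivative (\<lambda>v. \<chi> i. M (axis i 1) v x)) (at x)"
    using L_deriv[OF assms]
    by (subst has_derivative_componentwise_within)
      (auto simp: Basis_vec_def inner_axis)
  then have "(G has_derivative (\<lambda>v. \<chi> i. M (axis i 1) v x)) (at x)"
    by (rule has_derivative_transform_within_open[OF _ open_H assms])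
      (simp add: grad_eq[OF ln_gderiv])
  then have "G differentiable (at x)"
    unfolding differentiable_def by blast
  then show ?thesis unfolding hessian_def using jacobian_works by blast
qed

text \<open>Both sides are the derivative in direction \<open>v\<close> of one function,
  \<open>G y \<bullet> u = L u y\<close>.\<close>

private lemma hessian_M: "x \<in> H \<Longrightarrow> (D2 x *v v) \<bullet> u = M u v x"
proof -
  assume x: "x \<in> H"
  have "((\<lambda>x. G x \<bullet> u) has_derivative (\<lambda>v. (D2 x *v v) \<bullet> u)) (at x)"
    using G_deriv[OF x] by (auto intro!: derivative_eq_intros)
  moreover have "G y \<bullet> u = L u y" if "y \<in> H" for y
  proof -
    have "(\<lambda>v. D v y) = (\<lambda>v. g y * (v \<bullet> G y))"
      using smooth_facts(1)[OF that] g_deriv[OF that] by (rule has_derivative_unique)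
    from fun_cong[OF this, of u] show ?thesis
      using g_pos[OF that] by (simp add: L_def field_simps inner_commute)
  qed
  ultimately have "(L u has_derivative (\<lambda>v. (D2 x *v v) \<bullet> u)) (at x)"
    by (rule has_derivative_transform_within_open[OF _ open_H x])
  from has_derivative_unique[OF this L_deriv[OF x]] show ?thesis by metis
qed

lemma D2_symmetric:
  "x \<in> H \<Longrightarrow> (D2 x *v v) \<bullet> u = (D2 x *v u) \<bullet> v"
  by (simp add: hessian_M M_def smooth_facts(4)[of x u v] mult.commute)

lemma g_cont: "continuous_on H g"
  using g_deriv has_derivative_continuous continuous_at_imp_continuous_on by metis

lemma G_cont: "continuous_on H G"
  using G_deriv has_derivative_continuous continuous_at_imp_continuous_on by metis

text \<open>A quadrature point may be a node, where an integrand enters through a one-sided limit;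
  continuity of \<open>D2\<close> identifies that limit.\<close>

lemma D2_cont:
  "continuous_on H D2"
proof -
  have D: "continuous_on H (D u)" for u
    using smooth_facts(2) has_derivative_continuous continuous_at_imp_continuous_on by metis
  have "continuous_on H (\<lambda>x. M u v x)" for u v
    unfolding M_def using g_pos
    by (intro continuous_intros smooth_facts(3) D g_cont) (force simp: less_imp_neq[symmetric])+
  then have "continuous_on H (\<lambda>x. \<chi> i j. M (axis i 1) (axis j 1) x)"
    by (intro continuous_on_vec_lambda)
  moreover have "(\<chi> i j. M (axis i 1) (axis j 1) x) = D2 x" if "x \<in> H" for x
    using hessian_M[OF that] by (simp add: vec_eq_iff matrix_vector_mult_basis column_def inner_axis flip: hessian_M[OF that])
  ultimately show ?thesis using continuous_on_eq by blast
qed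

end

end

subsection \<open>Piecewise affine functions and quadrature\<close>

lemma node_less: "j \<in> {1..J} \<Longrightarrow> node J (j - 1) < node J j"
  by (auto simp: node_def divide_strict_right_mono)

lemma node_diff: "j \<in> {1..J} \<Longrightarrow> node J j - node J (j - 1) = 1 / real J"
  by (auto simp: node_def of_nat_diff field_simps)

lemma interior_element: "interior (element J j) = {node J (j - 1)<..<node J j}"
  by (simp add: element_def)

text \<open>The constant derivative on element \<open>j\<close>; the factor is the reciprocal of the
  element length \<open>1 / real J\<close>.\<close>

definition slope :: "nat \<Rightarrow> nat \<Rightarrow> (real \<Rightarrow> 'v::real_normed_vector) \<Rightarrow> 'v" where
  "slope J j u = real J *\<^sub>R (u (node J j) - u (node J (j - 1)))"

text \<open>A common description of \<open>Vh\<close> and \<open>VVh\<close> for any normed target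
  space. Continuity is not part of it but follows, because the affine formula holds on closed
  elements.\<close>

definition pw_affine :: "nat \<Rightarrow> (real \<Rightarrow> 'v::real_normed_vector) \<Rightarrow> bool" where
  "pw_affine J u \<longleftrightarrow> (\<forall>r. u (r + 1) = u r) \<and>
     (\<forall>j\<in>{1..J}. \<forall>r\<in>element J j. u r = u (node J (j - 1)) + (r - node J (j - 1)) *\<^sub>R slope J j u)"

lemma affine_slope:
  assumes j: "j \<in> {1..J}" and u: "\<forall>r\<in>element J j. u r = a + r *\<^sub>R b" and r: "r \<in> element J j"
  shows "u r = u (node J (j - 1)) + (r - node J (j - 1)) *\<^sub>R slope J j u"
proof -
  have nodes: "node J (j - 1) \<in> element J j" "node J j \<in> element J j"
    using node_less[OF j] by (auto simp: element_def)
  have "u (node J j) - u (node J (j - 1)) = (node J j - node J (j - 1)) *\<^sub>R b"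
    using u nodes by (simp add: algebra_simps)
  then have "slope J j u = b"
    unfolding slope_def node_diff[OF j] using j by simp
  then show ?thesis using u nodes r by (simp add: algebra_simps)
qed

text \<open>The closed elements cover \<open>{0..1}\<close>, and neighbouring affine pieces share
  their value at the common node. Periodicity carries continuity to every interval between
  consecutive integers, and two adjacent ones contain a neighbourhood of any point.\<close>

lemma pw_affine_continuous:
  assumes J: "J > 0" and u: "pw_affine J u"
  shows "continuous_on UNIV u"
proof -
  have "continuous_on (element J j) u" if j: "j \<in> {1..J}" for j
  proof -
    have "continuous_on (element J j) (\<lambda>r. u (node J (j - 1)) + (r - node J (j - 1)) *\<^sub>R slope J j u)"
      by (intro continuous_intros)
    then show ?thesis
      using u j unfolding pw_affine_def by (metis (no_types, lifting) continuous_on_cong)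
  qed
  then have "continuous_on (\<Union>j\<in>{1..J}. element J j) u"
    by (intro continuous_on_closed_Union) (auto simp: element_def)
  moreover have "{0..1} \<subseteq> (\<Union>j\<in>{1..J}. element J j)"
  proof
    fix r :: real assume r: "r \<in> {0..1}"
    show "r \<in> (\<Union>j\<in>{1..J}. element J j)"
    proof (cases "r = 0")
      case True
      then show ?thesis using J by (auto simp: element_def node_def intro!: bexI[of _ 1])
    next
      case False
      \<comment> \<open>The element with \<open>r\<close> in its interior or at its right end; the
        point 0 is treated apart because rounding up would give index 0.\<close>
      define j where "j = nat \<lceil>r * real J\<rceil>"
      have pos: "r * real J > 0" using False r J by simp
      have le: "r * real J \<le> real J" using r J by (simp add: mult_left_le_one_le)
      have j1: "real j - 1 < r * real J" "r * real J \<le> real j"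
        using pos by (auto simp: j_def) linarith+
      then have "j \<ge> 1" using pos by (cases j) auto
      moreover have "j \<le> J" using le pos unfolding j_def by (simp add: nat_le_iff ceiling_le_iff)
      ultimately have "r \<in> element J j"
        using j1 J by (auto simp: element_def node_def of_nat_diff field_simps)
      with \<open>j \<ge> 1\<close> \<open>j \<le> J\<close> show ?thesis by auto
    qed
  qed
  ultimately have unit: "continuous_on {0..1} u" by (rule continuous_on_subset)
  have shift: "u (r - real_of_int n) = u r" for r n
  proof (induction n arbitrary: r rule: int_induct[where k = 0])
    case (step1 i)
    have "u (r - real_of_int (i + 1)) = u ((r - 1) - real_of_int i)" by (simp add: algebra_simps)
    also have "\<dots> = u (r - 1)" by (rule step1.IH)
    also have "\<dots> = u r" using u unfolding pw_affine_def by (metis diff_add_cancel)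
    finally show ?case .
  next
    case (step2 i)
    have "u (r - real_of_int (i - 1)) = u ((r + 1) - real_of_int i)" by (simp add: algebra_simps)
    also have "\<dots> = u (r + 1)" by (rule step2.IH)
    also have "\<dots> = u r" using u unfolding pw_affine_def by metis
    finally show ?case .
  qed auto
  have piece: "continuous_on {real_of_int n..real_of_int n + 1} u" for n
  proof -
    have "continuous_on {real_of_int n..real_of_int n + 1} (\<lambda>r. u (r - real_of_int n))"
      by (rule continuous_on_compose2[OF unit]) (auto intro!: continuous_intros)
    then show ?thesis by (simp only: shift)
  qed
  have "isCont u r" for r
  proof -
    \<comment> \<open>Rounding up and subtracting 1 makes \<open>r\<close> an interior point of the
      union of two unit intervals even when \<open>r\<close> is an integer.\<close>
    define n where "n = \<lceil>r\<rceil> - 1"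
    have n: "real_of_int n < r" "r \<le> real_of_int n + 1" unfolding n_def by linarith+
    have "continuous_on ({real_of_int n..real_of_int n + 1} \<union> {real_of_int (n + 1)..real_of_int (n + 1) + 1}) u"
      by (intro continuous_on_closed_Un piece) auto
    then have "continuous_on {real_of_int n<..<real_of_int n + 2} u"
      by (rule continuous_on_subset) auto
    then show ?thesis using n by (subst (asm) continuous_on_eq_continuous_at) auto
  qed
  then show ?thesis by (simp add: continuous_at_imp_continuous_on)
qed

lemma Vh_iff_pw_affine: "J > 0 \<Longrightarrow> u \<in> Vh J \<longleftrightarrow> pw_affine J u"
proof
  assume u: "u \<in> Vh J"
  have "u r = u (node J (j - 1)) + (r - node J (j - 1)) *\<^sub>R slope J j u"
    if j: "j \<in> {1..J}" and r: "r \<in> element J j" for j r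
  proof -
    from u j obtain a b where "\<forall>r\<in>element J j. u r = a + b * r" unfolding Vh_def by blast
    then have "\<forall>r\<in>element J j. u r = a + r *\<^sub>R b" by (simp add: mult.commute)
    from affine_slope[OF j this r] show ?thesis .
  qed
  then show "pw_affine J u" using u unfolding pw_affine_def Vh_def by blast
next
  assume "J > 0" "pw_affine J u"
  have "\<exists>a b. \<forall>r\<in>element J j. u r = a + b * r" if "j \<in> {1..J}" for j
    using \<open>pw_affine J u\<close> that unfolding pw_affine_def
    by (intro exI[of _ "u (node J (j - 1)) - node J (j - 1) * slope J j u"] exI[of _ "slope J j u"] ballI)
      (auto simp: algebra_simps)
  then show "u \<in> Vh J"
    using pw_affine_continuous[OF \<open>J > 0\<close> \<open>pw_affine J u\<close>] \<open>pw_affine J u\<close>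
    by (auto simp: Vh_def pw_affine_def)
qed

lemma VVh_iff_pw_affine: "J > 0 \<Longrightarrow> u \<in> VVh J \<longleftrightarrow> pw_affine J u"
  unfolding VVh_def mem_Collect_eq Vh_iff_pw_affine
  by (auto simp: pw_affine_def slope_def vec_eq_iff)

lemma d\<rho>_pw_affine:
  assumes u: "pw_affine J u" and j: "j \<in> {1..J}" and r: "r \<in> interior (element J j)"
  shows "d\<rho> u r = slope J j u"
proof -
  have "((\<lambda>r. u (node J (j - 1)) + (r - node J (j - 1)) *\<^sub>R slope J j u) has_vector_derivative slope J j u) (at r)"
    by (auto intro!: derivative_eq_intros)
  then have "(u has_vector_derivative slope J j u) (at r)"
    by (rule has_vector_derivative_transform_within_open[OF _ open_interior r])
      (use u j interior_subset[of "element J j"] in \<open>auto simp: pw_affine_def\<close>)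
  then show ?thesis unfolding d\<rho>_def by (rule vector_derivative_at)
qed

text \<open>Since \<open>d\<rho>\<close> is constant inside each element, nondegeneracy amounts to
  finitely many conditions on vectors. This is what makes it stable under small changes of
  time.\<close>

lemma nondegenerate_iff_slope:
  assumes "pw_affine J X"
  shows "nondegenerate J X \<longleftrightarrow> (\<forall>j\<in>{1..J}. slope J j X \<noteq> 0)"
proof -
  have "interior (element J j) \<noteq> {}" if "j \<in> {1..J}" for j
    using node_less[OF that] by (simp add: interior_element)
  then show ?thesis
    unfolding nondegenerate_def len_def using d\<rho>_pw_affine[OF assms] by fastforce
qed

section \<open>Quadrature as a finite weighted sum\<close>

lemma value_in_continuous:
  assumes ab: "a < b" and F: "continuous_on {a..b} F" and eq: "\<And>r. r \<in> {a<..<b} \<Longrightarrow> f r = F r"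
    and r: "r \<in> {a..b}"
  shows "value_in a b f r = F r"
proof -
  have "(F \<longlongrightarrow> F a) (at_right a)" "(F \<longlongrightarrow> F b) (at_left b)"
    using continuous_on_Icc_at_rightD[OF F ab] continuous_on_Icc_at_leftD[OF F ab] by auto
  moreover have "\<forall>\<^sub>F r in at_right a. F r = f r" "\<forall>\<^sub>F r in at_left b. F r = f r"
    using eventually_at_right_real[OF ab] eventually_at_left_real[OF ab] eq
    by (auto elim!: eventually_mono)
  ultimately have "(f \<longlongrightarrow> F a) (at_right a)" "(f \<longlongrightarrow> F b) (at_left b)"
    by (auto intro: Lim_transform_eventually)
  then have "Lim (at_right a) f = F a" "Lim (at_left b) f = F b"
    by (auto intro!: tendsto_Lim)
  then show ?thesis using r eq by (auto simp: value_in_def)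
qed

definition quad_point :: "nat \<Rightarrow> (nat \<Rightarrow> real) \<Rightarrow> nat \<Rightarrow> nat \<Rightarrow> real" where
  "quad_point J \<alpha> j k = \<alpha> k * node J (j - 1) + (1 - \<alpha> k) * node J j"

text \<open>The summand is indexed by element and quadrature index rather than by the point, because
  an integrand may have two different one-sided limits at a node shared by two elements.\<close>

definition quad_sum :: "nat \<Rightarrow> nat \<Rightarrow> (nat \<Rightarrow> real) \<Rightarrow> (nat \<Rightarrow> nat \<Rightarrow> real) \<Rightarrow> real" where
  "quad_sum J K w c = (\<Sum>j=1..J. 1 / real J * (\<Sum>k=1..K. w k * c j k))"

lemma quad_sum_add: "quad_sum J K w (\<lambda>j k. c j k + d j k) = quad_sum J K w c + quad_sum J K w d"
  by (simp add: quad_sum_def sum.distrib algebra_simps)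

lemma quad_sum_mult: "quad_sum J K w (\<lambda>j k. a * c j k) = a * quad_sum J K w c"
  by (simp add: quad_sum_def sum_distrib_left algebra_simps)

lemma quad_sum_cong:
  "(\<And>j k. j \<in> {1..J} \<Longrightarrow> k \<in> {1..K} \<Longrightarrow> c j k = d j k) \<Longrightarrow> quad_sum J K w c = quad_sum J K w d"
  by (simp add: quad_sum_def)

lemma DERIV_quad_sum:
  "(\<And>j k. j \<in> {1..J} \<Longrightarrow> k \<in> {1..K} \<Longrightarrow> ((\<lambda>s. c s j k) has_real_derivative d j k) (at t)) \<Longrightarrow>
   ((\<lambda>s. quad_sum J K w (c s)) has_real_derivative quad_sum J K w d) (at t)"
  unfolding quad_sum_def by (auto intro!: derivative_eq_intros sum.cong)

lemma quad_point_in_element: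
  assumes "quadrature_rule K w \<alpha>" "j \<in> {1..J}" "k \<in> {1..K}"
  shows "quad_point J \<alpha> j k \<in> element J j"
proof -
  have "0 \<le> \<alpha> k" "\<alpha> k \<le> 1" using assms by (auto simp: quadrature_rule_def)
  then show ?thesis
    \<comment> \<open>The second convexity bound is taken for the negated point and yields the lower
      end of the element.\<close>
    using node_less[OF assms(2)]
      convex_bound_le[of "node J (j - 1)" "node J j" "node J j" "\<alpha> k" "1 - \<alpha> k"]
      convex_bound_le[of "- node J (j - 1)" "- node J (j - 1)" "- node J j" "\<alpha> k" "1 - \<alpha> k"]
    by (simp add: element_def quad_point_def)
qed

text \<open>On each element the integrand is replaced by a continuous extension \<open>F j\<close>
  from the interior, which turns the one-sided limits into plain values. \<open>F\<close> depends on
  \<open>j\<close> because slopes and normals jump at the nodes.\<close>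

lemma quad_eq_quad_sum:
  assumes rule: "quadrature_rule K w \<alpha>"
    and F: "\<And>j. j \<in> {1..J} \<Longrightarrow> continuous_on (element J j) (F j)"
    and eq: "\<And>j r. j \<in> {1..J} \<Longrightarrow> r \<in> interior (element J j) \<Longrightarrow> f r = F j r"
  shows "quad J K w \<alpha> f = quad_sum J K w (\<lambda>j k. F j (quad_point J \<alpha> j k))"
proof -
  have "value_in (node J (j - 1)) (node J j) f (quad_point J \<alpha> j k) = F j (quad_point J \<alpha> j k)"
    if "j \<in> {1..J}" "k \<in> {1..K}" for j k
    using node_less[OF that(1)] F[OF that(1)] eq[OF that(1)] quad_point_in_element[OF rule that]
    unfolding interior_element element_def by (intro value_in_continuous) auto
  then show ?thesis by (simp add: quad_def quad_sum_def quad_point_def)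
qed

section \<open>Time derivatives of piecewise affine functions\<close>

lemma dt_has_vector_derivative:
  assumes "differentiable_in_time T u" "t \<in> {0<..<T}"
  shows "((\<lambda>s. u s r) has_vector_derivative dt T u t r) (at t)"
proof -
  have "at t within {0<..T} = at t" using assms(2) by (intro at_within_interior) auto
  then show ?thesis
    using assms by (force simp: differentiable_in_time_def dt_def vector_derivative_works)
qed

text \<open>A slope is a fixed linear combination of two nodal values, so it commutes with
  differentiation in time; no interchange of limits is involved.\<close>

lemma slope_dt:
  assumes "differentiable_in_time T u" "t \<in> {0<..<T}"
  shows "((\<lambda>s. slope J j (u s)) has_vector_derivative slope J j (dt T u t)) (at t)"
  unfolding slope_def by (auto intro!: derivative_eq_intros dt_has_vector_derivative assms)

text \<open>Periodicity and the affine formula are linear relations between finitely many values and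
  survive differentiation by uniqueness of derivatives. Hence \<open>X\<^sub>t\<close> and
  \<open>\<kappa>\<^sub>t\<close> are admissible test functions.\<close>

lemma pw_affine_dt:
  assumes u: "differentiable_in_time T u" "t \<in> {0<..<T}" and pw: "\<And>s. s \<in> {0<..<T} \<Longrightarrow> pw_affine J (u s)"
  shows "pw_affine J (dt T u t)"
proof -
  note d = dt_has_vector_derivative[OF u]
  have unique: "a = b" if "(f has_vector_derivative a) (at t)" "(h has_vector_derivative b) (at t)"
    "\<And>s. s \<in> {0<..<T} \<Longrightarrow> f s = h s" for a b f h
    using has_vector_derivative_transform_within_open[OF that(1) open_greaterThanLessThan u(2) that(3)] that(2)
    by (rule vector_derivative_unique_at)
  have "dt T u t (r + 1) = dt T u t r" for r
    by (rule unique[OF d d]) (use pw in \<open>auto simp: pw_affine_def\<close>)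
  moreover have "dt T u t r = dt T u t (node J (j - 1)) + (r - node J (j - 1)) *\<^sub>R slope J j (dt T u t)"
    if "j \<in> {1..J}" "r \<in> element J j" for j r
  proof (rule unique[OF d])
    show "((\<lambda>s. u s (node J (j - 1)) + (r - node J (j - 1)) *\<^sub>R slope J j (u s)) has_vector_derivative
        dt T u t (node J (j - 1)) + (r - node J (j - 1)) *\<^sub>R slope J j (dt T u t)) (at t)"
      by (auto intro!: derivative_eq_intros d slope_dt[OF u])
  qed (use pw that in \<open>auto simp: pw_affine_def\<close>)
  ultimately show ?thesis unfolding pw_affine_def by blast
qed

section \<open>Rotation in the plane\<close>

lemma perp_scaleR: "perp (c *\<^sub>R a) = c *\<^sub>R perp a"
  by (simp add: perp_def vec_eq_iff forall_2)

lemma inner_perp: "perp a \<bullet> b = - (a \<bullet> perp b)"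
  by (simp add: perp_def inner_vec_def sum_2)

text \<open>The inner product of \<open>q\<close> and \<open>z\<close> is expanded along the
  orthogonal vectors \<open>p\<close> and \<open>perp p\<close>; moving \<open>perp\<close> to the
  other factor changes the sign twice in the second product.\<close>

lemma inner_perp_decomposition:
  "(norm p)\<^sup>2 * (q \<bullet> z) = (p \<bullet> q) * (p \<bullet> z) + (p \<bullet> perp q) * (p \<bullet> perp z)"
  unfolding power2_norm_eq_inner by (simp add: perp_def inner_vec_def sum_2 algebra_simps)

lemma continuous_on_perp [continuous_intros]:
  assumes "continuous_on S f"
  shows "continuous_on S (\<lambda>x. perp (f x))"
proof -
  have "perp a = a $ 2 *\<^sub>R axis 1 1 - a $ 1 *\<^sub>R axis 2 1" for a
    by (simp add: perp_def vec_eq_iff forall_2 axis_def)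
  then show ?thesis using assms by (auto intro!: continuous_intros)
qed

lemma continuous_on_matrix_vector_mult:
  fixes A :: "'a::topological_space \<Rightarrow> real^'n^'m"
  assumes "continuous_on S A" "continuous_on S v"
  shows "continuous_on S (\<lambda>x. A x *v v x)"
  unfolding matrix_vector_mult_def using assms by (intro continuous_intros)

section \<open>Nondegeneracy at almost every time\<close>

lemma nondegenerate_AE:
  assumes pw: "\<And>t. t \<in> {0<..<T} \<Longrightarrow> pw_affine J (X t)"
    and ae: "AE p in lborel. p \<in> {0..1} \<times> {0<..<T} \<longrightarrow> len (X (snd p)) (fst p) > 0"
  shows "AE t in lborel. t \<in> {0<..<T} \<longrightarrow> nondegenerate J (X t)"
proof -
  have "AE p in lborel \<Otimes>\<^sub>M lborel. p \<in> {0..1} \<times> {0<..<T} \<longrightarrow> len (X (snd p)) (fst p) > 0"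
    using ae by (simp only: lborel_prod)
  \<comment> \<open>The pairs carry the parameter first and the time second; they are swapped so
    that slicing fixes the time.\<close>
  then have "AE p in distr (lborel \<Otimes>\<^sub>M lborel) (lborel \<Otimes>\<^sub>M lborel) (\<lambda>(x, y). (y, x)).
      p \<in> {0..1} \<times> {0<..<T} \<longrightarrow> len (X (snd p)) (fst p :: real) > 0"
    by (simp only: lborel_pair.distr_pair_swap[symmetric])
  from AE_distrD[OF measurable_pair_swap' this]
  have "AE p in lborel \<Otimes>\<^sub>M lborel. fst p \<in> {0<..<T} \<longrightarrow> snd p \<in> {0..1} \<longrightarrow> len (X (fst p)) (snd p) > 0"
    by (auto simp: case_prod_beta)
  from lborel_pair.AE_pair[OF this]
  have "AE t in lborel. AE r in lborel. t \<in> {0<..<T} \<longrightarrow> r \<in> {0..1} \<longrightarrow> len (X t) r > 0"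
    by simp
  then show ?thesis
  proof (rule eventually_mono, intro impI)
    fix t assume t: "t \<in> {0<..<T}"
      and ae: "AE r in lborel. t \<in> {0<..<T} \<longrightarrow> r \<in> {0..1} \<longrightarrow> len (X t) r > 0"
    \<comment> \<open>A vanishing slope makes \<open>len\<close> zero on a whole open element, which
      has positive measure.\<close>
    have "slope J j (X t) \<noteq> 0" if j: "j \<in> {1..J}" for j
    proof
      assume 0: "slope J j (X t) = 0"
      have len0: "len (X t) r = 0" if "r \<in> interior (element J j)" for r
        using d\<rho>_pw_affine[OF pw[OF t] j that] 0 by (simp add: len_def)
      have sub: "r \<in> {0..1}" if "r \<in> interior (element J j)" for r
      proof -
        have "0 \<le> node J (j - 1)" "node J j \<le> 1"
          using j by (auto simp: node_def divide_le_eq_1)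
        then show ?thesis using that unfolding interior_element by auto
      qed
      have "AE r in lborel. r \<notin> {node J (j - 1)<..<node J j}"
        using ae by eventually_elim (use len0 sub t in \<open>fastforce simp: interior_element\<close>)
      then have "emeasure lborel {node J (j - 1)<..<node J j} = 0"
        by (subst (asm) AE_iff_measurable[where N = "{node J (j - 1)<..<node J j}"]) auto
      then show False using node_less[OF j] by (simp add: ennreal_eq_0_iff)
    qed
    then show "nondegenerate J (X t)" using nondegenerate_iff_slope[OF pw[OF t]] by blast
  qed
qed

subsection \<open>Variation of the integrands\<close>

context metric
begin

text \<open>The integrand of the left-hand side of (iii) tested with \<open>Y\<close>, after cancelling the element
  length in the first term; \<open>p\<close>, \<open>z\<close> and \<open>q\<close> stand for the derivatives of
  \<open>X\<close>, \<open>Y\<close> and \<open>X\<^sub>t\<close> with respect to the parameter.\<close>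

definition curvature_form :: "real^2 \<Rightarrow> real \<Rightarrow> real^2 \<Rightarrow> real^2 \<Rightarrow> real^2 \<Rightarrow> real" where
  "curvature_form x k p y z =
     g x * k * (p \<bullet> perp y) + sqrt (g x) * (p \<bullet> z) / norm p + 1/2 * (sqrt (g x) * norm p * (G x \<bullet> y))"

text \<open>The time derivative of \<open>curvature_form\<close> when \<open>x\<close>,
  \<open>k\<close>, \<open>p\<close> move with velocities \<open>v\<close>, \<open>kt\<close>,
  \<open>q\<close>, while \<open>y\<close> and \<open>z\<close> stay fixed because the test function
  is frozen.\<close>

definition curvature_form_deriv ::
    "real^2 \<Rightarrow> real \<Rightarrow> real^2 \<Rightarrow> real^2 \<Rightarrow> real^2 \<Rightarrow> real^2 \<Rightarrow> real \<Rightarrow> real^2 \<Rightarrow> real" where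
  "curvature_form_deriv x k p y z v kt q =
     g x * (v \<bullet> G x) * k * (p \<bullet> perp y) + g x * kt * (p \<bullet> perp y) + g x * k * (q \<bullet> perp y)
     + sqrt (g x) * (v \<bullet> G x) / 2 * (p \<bullet> z) / norm p + sqrt (g x) * (q \<bullet> z) / norm p
     - sqrt (g x) * (p \<bullet> z) * (p \<bullet> q) / norm p ^ 3
     + 1/2 * (sqrt (g x) * (v \<bullet> G x) / 2 * norm p * (G x \<bullet> y) + sqrt (g x) * (p \<bullet> q) / norm p * (G x \<bullet> y)
       + sqrt (g x) * norm p * ((D2 x *v v) \<bullet> y))"

definition energy_density :: "real \<Rightarrow> real^2 \<Rightarrow> real \<Rightarrow> real^2 \<Rightarrow> real" where
  "energy_density lam x k p = (k\<^sup>2 + 2 * lam) * (sqrt (g x) * norm p)"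

definition energy_density_deriv :: "real \<Rightarrow> real^2 \<Rightarrow> real \<Rightarrow> real^2 \<Rightarrow> real^2 \<Rightarrow> real \<Rightarrow> real^2 \<Rightarrow> real" where
  "energy_density_deriv lam x k p v kt q =
     2 * k * kt * (sqrt (g x) * norm p)
     + (k\<^sup>2 + 2 * lam) * (sqrt (g x) * (v \<bullet> G x) / 2 * norm p + sqrt (g x) * (p \<bullet> q) / norm p)"

context
  fixes x p :: "real \<Rightarrow> real^2" and k :: "real \<Rightarrow> real" and v q :: "real^2" and kt t :: real
  assumes x: "(x has_vector_derivative v) (at t)" and xH: "x t \<in> H"
    and k: "(k has_real_derivative kt) (at t)"
    and p: "(p has_vector_derivative q) (at t)" and p0: "p t \<noteq> 0"
begin

private lemma deriv_compose:
  fixes f :: "real^2 \<Rightarrow> real"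
  assumes f: "(f has_derivative f') (at (u t))" and u: "(u has_vector_derivative u') (at t)"
  shows "((\<lambda>s. f (u s)) has_real_derivative f' u') (at t)"
proof -
  have "(\<lambda>c. f' (c *\<^sub>R u')) = (*) (f' u')"
    using linear_cmul[OF has_derivative_linear[OF f]] by (auto simp: mult.commute)
  then show ?thesis
    using has_derivative_compose[OF u[unfolded has_vector_derivative_def] f]
    by (simp add: has_field_derivative_def)
qed

private lemma deriv_g: "((\<lambda>s. g (x s)) has_real_derivative g (x t) * (v \<bullet> G (x t))) (at t)"
  using deriv_compose[OF g_deriv[OF xH] x] .

private lemma deriv_inner: "((\<lambda>s. u s \<bullet> y) has_real_derivative u' \<bullet> y) (at t)"
  if "(u has_vector_derivative u') (at t)" for u u' and y :: "real^2"
  by (rule deriv_compose[OF bounded_linear_imp_has_derivative[OF bounded_linear_inner_left] that])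

private lemma deriv_norm: "((\<lambda>s. norm (p s)) has_real_derivative (p t \<bullet> q) / norm (p t)) (at t)"
  using deriv_compose[OF has_derivative_norm[OF p0] p]
  by (simp add: sgn_div_norm inner_commute divide_inverse mult.commute)

private lemma deriv_G: "((\<lambda>s. G (x s)) has_vector_derivative D2 (x t) *v v) (at t)"
  using has_derivative_compose[OF x[unfolded has_vector_derivative_def] G_deriv[OF xH]]
  by (simp add: has_vector_derivative_def matrix_vector_mult_scaleR)

private lemma deriv_sqrt_g: "((\<lambda>s. sqrt (g (x s))) has_real_derivative sqrt (g (x t)) * (v \<bullet> G (x t)) / 2) (at t)"
proof -
  \<comment> \<open>With \<open>g = c * c\<close>, the chain rule expression
    \<open>g * (v \<bullet> G) / (2 * sqrt g)\<close> reduces to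
    \<open>c * (v \<bullet> G) / 2\<close> by field arithmetic.\<close>
  define c where "c = sqrt (g (x t))"
  have c: "c > 0" "g (x t) = c * c" using g_pos[OF xH] by (simp_all add: c_def)
  show ?thesis
    by (rule DERIV_cong[OF DERIV_chain2[OF DERIV_real_sqrt[OF g_pos[OF xH]] deriv_g]])
      (use c in \<open>simp add: c_def[symmetric] field_simps\<close>)
qed

lemma DERIV_energy_density:
  "((\<lambda>s. energy_density lam (x s) (k s) (p s)) has_real_derivative
     energy_density_deriv lam (x t) (k t) (p t) v kt q) (at t)"
proof -
  have k2: "((\<lambda>s. (k s)\<^sup>2 + 2 * lam) has_real_derivative 2 * k t * kt) (at t)"
    by (auto intro!: derivative_eq_intros k)
  show ?thesis
    unfolding energy_density_def energy_density_deriv_def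
    by (rule DERIV_cong, (rule DERIV_mult k2 deriv_sqrt_g deriv_norm)+) (simp add: algebra_simps)
qed

lemma DERIV_curvature_form:
  "((\<lambda>s. curvature_form (x s) (k s) (p s) y z) has_real_derivative
     curvature_form_deriv (x t) (k t) (p t) y z v kt q) (at t)"
proof -
  have A2: "((\<lambda>s. sqrt (g (x s)) * (p s \<bullet> z) / norm (p s)) has_real_derivative
      sqrt (g (x t)) * (v \<bullet> G (x t)) / 2 * (p t \<bullet> z) / norm (p t) + sqrt (g (x t)) * (q \<bullet> z) / norm (p t)
      - sqrt (g (x t)) * (p t \<bullet> z) * (p t \<bullet> q) / norm (p t) ^ 3) (at t)"
    by (rule DERIV_cong, (rule DERIV_divide DERIV_mult deriv_sqrt_g deriv_norm deriv_inner[OF p])+)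
      (use p0 in \<open>simp_all add: field_simps power2_eq_square power3_eq_cube\<close>)
  have A1: "((\<lambda>s. g (x s) * k s * (p s \<bullet> perp y)) has_real_derivative
      g (x t) * (v \<bullet> G (x t)) * k t * (p t \<bullet> perp y) + g (x t) * kt * (p t \<bullet> perp y)
      + g (x t) * k t * (q \<bullet> perp y)) (at t)"
    by (rule DERIV_cong, (rule DERIV_mult deriv_g k deriv_inner[OF p])+) (simp add: algebra_simps)
  have A3: "((\<lambda>s. 1/2 * (sqrt (g (x s)) * norm (p s) * (G (x s) \<bullet> y))) has_real_derivative
      1/2 * (sqrt (g (x t)) * (v \<bullet> G (x t)) / 2 * norm (p t) * (G (x t) \<bullet> y)
       + sqrt (g (x t)) * (p t \<bullet> q) / norm (p t) * (G (x t) \<bullet> y)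
       + sqrt (g (x t)) * norm (p t) * ((D2 (x t) *v v) \<bullet> y))) (at t)"
    by (rule DERIV_cong, (rule DERIV_cmult DERIV_mult deriv_sqrt_g deriv_norm deriv_inner[OF deriv_G])+)
      (simp add: algebra_simps)
  show ?thesis
    unfolding curvature_form_def curvature_form_deriv_def
    by (rule DERIV_cong[OF DERIV_add[OF DERIV_add[OF A1 A2] A3]]) (simp add: algebra_simps)
qed

end

text \<open>The coefficients of scheme (i) tested with \<open>X\<^sub>t\<close>, of scheme (ii) tested with \<open>\<kappa>\<^sub>t\<close>
  and of the time derivative of scheme (iii) tested with \<open>Y\<close>.\<close>

lemma pointwise_identity:
  fixes x p y z v q :: "real^2" and k kt lam :: real
  defines "\<tau> \<equiv> inverse (norm p) *\<^sub>R p"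
  defines "\<nu> \<equiv> - perp \<tau>"
  defines "l \<equiv> sqrt (g x) * norm p"
  assumes xH: "x \<in> H" and p: "p \<noteq> 0"
  shows "(inverse (norm p) *\<^sub>R z \<bullet> \<nu>) * ((inverse (norm p) *\<^sub>R q \<bullet> \<nu>) * l)
     + (- (1/2) * ((k\<^sup>2 + 2 * lam - y \<bullet> G x) * ((inverse (norm p) *\<^sub>R q \<bullet> \<tau> + 1/2 * (v \<bullet> G x)) * l))
     + 1/2 * ((D2 x *v y) \<bullet> (l *\<^sub>R v))
     + (sqrt (g x) * k) * ((inverse (norm p) *\<^sub>R q \<bullet> perp y) * l)
     + (sqrt (g x) * k * (y \<bullet> \<nu>) + 1/2 * (inverse (norm p) *\<^sub>R z \<bullet> \<tau>)) * ((v \<bullet> G x) * l))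
     + 1/2 * energy_density_deriv lam x k p v kt q
   = (k - sqrt (g x) * (y \<bullet> \<nu>)) * (kt * l) + curvature_form_deriv x k p y z v kt q"
proof -
  define n where "n = norm p"
  have n: "n > 0" using p by (simp add: n_def)
  define c where "c = sqrt (g x)"
  have c: "g x = c * c" using g_pos[OF xH] by (simp add: c_def)
  have inner_\<nu>: "u \<bullet> \<nu> = (p \<bullet> perp u) / n" for u
    by (simp add: \<nu>_def \<tau>_def n_def perp_scaleR inner_perp[of p u] inner_commute[of u] divide_inverse mult.commute)
  have inner_\<tau>: "u \<bullet> \<tau> = (p \<bullet> u) / n" for u
    by (simp add: \<tau>_def n_def inner_commute divide_inverse mult.commute)
  \<comment> \<open>\<open>pz\<close>, \<open>pq\<close> are the tangential and \<open>Pz\<close>,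
    \<open>Pq\<close> the normal components of the arc length derivatives of \<open>Y\<close> and
    \<open>X\<^sub>t\<close>, and \<open>Py\<close> is the normal component of \<open>Y\<close>.
    Replacing the inner products by these makes all powers of \<open>n\<close> explicit.\<close>
  define pz pq Pz Pq Py Qy where "pz = (p \<bullet> z) / n\<^sup>2" and "pq = (p \<bullet> q) / n\<^sup>2"
    and "Pz = (p \<bullet> perp z) / n\<^sup>2" and "Pq = (p \<bullet> perp q) / n\<^sup>2"
    and "Py = (p \<bullet> perp y) / n" and "Qy = (q \<bullet> perp y) / n"
  then have scaled: "p \<bullet> z = n * n * pz" "p \<bullet> q = n * n * pq" "p \<bullet> perp z = n * n * Pz"
    "p \<bullet> perp q = n * n * Pq" "p \<bullet> perp y = n * Py" "q \<bullet> perp y = n * Qy"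
    using n by (simp_all add: power2_eq_square)
  \<comment> \<open>The tangential product \<open>pq * pz\<close> cancels against the term from
    differentiating \<open>1 / norm p\<close>; the normal product \<open>Pq * Pz\<close> is the
    second term of scheme (i).\<close>
  have "(n * n) * (q \<bullet> z) = (n * n) * (n * n * (pq * pz + Pq * Pz))"
    using inner_perp_decomposition[of p q z] unfolding n_def[symmetric] scaled
    by (simp add: algebra_simps power2_eq_square)
  then have qz: "q \<bullet> z = n * n * (pq * pz + Pq * Pz)" using n by simp
  \<comment> \<open>Scheme (i) pairs the Hessian applied to \<open>Y\<close> with
    \<open>X\<^sub>t\<close>, whereas the time derivative of \<open>G\<close> produces the Hessian
    applied to \<open>X\<^sub>t\<close> and paired with \<open>Y\<close>.\<close>
  have D2: "(D2 x *v v) \<bullet> y = (D2 x *v y) \<bullet> v" by (rule D2_symmetric[OF xH])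
  show ?thesis
    unfolding energy_density_deriv_def curvature_form_deriv_def inner_scaleR_left inner_scaleR_right
      inner_\<nu> inner_\<tau> l_def n_def[symmetric] c_def[symmetric] inner_commute[of y "G x"] D2 perp_scaleR
      scaled qz
    unfolding c inverse_eq_divide
    using n by (simp add: power3_eq_cube) (simp add: field_simps power2_eq_square)
qed

end

subsection \<open>The energy identity\<close>

context metric
begin

section \<open>The scheme at a fixed time as quadrature sums\<close>

context
  fixes J K :: nat and w \<alpha> :: "nat \<Rightarrow> real" and X :: "real \<Rightarrow> real^2" and \<kappa> :: "real \<Rightarrow> real"
  assumes J: "J > 0" and rule: "quadrature_rule K w \<alpha>" and X: "pw_affine J X" and XH: "\<And>r. X r \<in> H"
    and \<kappa>: "pw_affine J \<kappa>"
begin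

private abbreviation "pt \<equiv> quad_point J \<alpha>"

private abbreviation "P j \<equiv> slope J j X"

private abbreviation "tangent j \<equiv> inverse (norm (P j)) *\<^sub>R P j"

private lemma continuous_element:
  "pw_affine J u \<Longrightarrow> continuous_on (element J j) u"
  using pw_affine_continuous[OF J] continuous_on_subset by blast

private lemma continuous_X:
  "continuous_on (element J j) (\<lambda>r. g (X r))"
  "continuous_on (element J j) (\<lambda>r. G (X r))"
  "continuous_on (element J j) (\<lambda>r. D2 (X r))"
  using continuous_on_compose2[OF g_cont continuous_element[OF X]]
    continuous_on_compose2[OF G_cont continuous_element[OF X]]
    continuous_on_compose2[OF D2_cont continuous_element[OF X]] XH
  by auto

private lemmas cont = continuous_intros continuous_X continuous_on_matrix_vector_mult
  continuous_element[OF X] continuous_element[OF \<kappa>]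

private lemma interior_values:
  assumes "j \<in> {1..J}" "r \<in> interior (element J j)"
  shows "len_g g X r = sqrt (g (X r)) * norm (P j)"
    and "tau X r = tangent j"
    and "nu X r = - perp (tangent j)"
    and "pw_affine J u \<Longrightarrow> ds X u r = inverse (norm (P j)) *\<^sub>R slope J j u"
    and "ds X X r = tangent j"
  using d\<rho>_pw_affine[OF X assms] d\<rho>_pw_affine[OF _ assms, of u]
  by (simp_all add: len_g_def len_def tau_def nu_def ds_def)

lemma energy_eq_quad_sum:
  "energy J K w \<alpha> g lam X \<kappa> = quad_sum J K w (\<lambda>j k. energy_density lam (X (pt j k)) (\<kappa> (pt j k)) (P j))"
  unfolding energy_def quad_ip_def energy_density_def
  by (rule quad_eq_quad_sum[OF rule, where F = "\<lambda>j r. ((\<kappa> r)\<^sup>2 + 2 * lam) * (sqrt (g (X r)) * norm (P j))"])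
    (auto intro!: cont simp: interior_values)

context
  fixes Y :: "real \<Rightarrow> real^2"
  assumes Y: "pw_affine J Y" and nondeg: "nondegenerate J X"
begin

private lemmas cont' = cont continuous_element[OF Y]

private lemma P0: "j \<in> {1..J} \<Longrightarrow> P j \<noteq> 0"
  using nondeg nondegenerate_iff_slope[OF X] by blast

lemma scheme_ii_quad_sum:
  assumes "scheme_ii J K w \<alpha> g X \<kappa> Y" and chi: "pw_affine J chi"
  shows "quad_sum J K w (\<lambda>j k. (\<kappa> (pt j k) - sqrt (g (X (pt j k))) * (Y (pt j k) \<bullet> - perp (tangent j))) *
    (chi (pt j k) * (sqrt (g (X (pt j k))) * norm (P j)))) = 0" (is "quad_sum J K w (\<lambda>j k. ?F j (pt j k)) = 0")
proof -
  have "quad_ip J K w \<alpha> (\<lambda>r. \<kappa> r - sqrt (g (X r)) * (Y r \<bullet> nu X r)) (\<lambda>r. chi r * len_g g X r) =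
      quad_sum J K w (\<lambda>j k. ?F j (pt j k))"
    unfolding quad_ip_def
    by (rule quad_eq_quad_sum[OF rule]) (auto intro!: cont' continuous_element[OF chi] simp: interior_values)
  then show ?thesis
    using assms J by (simp add: scheme_ii_def Vh_iff_pw_affine)
qed

text \<open>\<open>Y\<close> may be any piecewise affine test function, so it can be frozen at one
  time while \<open>X\<close> and \<open>\<kappa>\<close> are taken at another.\<close>

lemma scheme_iii_quad_sum:
  assumes "scheme_iii J K w \<alpha> g X \<kappa>"
  shows "quad_sum J K w (\<lambda>j k. curvature_form (X (pt j k)) (\<kappa> (pt j k)) (P j) (Y (pt j k)) (slope J j Y)) = 0"
proof -
  have 1: "quad_ip J K w \<alpha> (\<lambda>r. (sqrt (g (X r)) * \<kappa> r) *\<^sub>R nu X r) (\<lambda>r. len_g g X r *\<^sub>R Y r) =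
      quad_sum J K w (\<lambda>j k. g (X (pt j k)) * \<kappa> (pt j k) * (P j \<bullet> perp (Y (pt j k))))"
    unfolding quad_ip_def
  proof (rule quad_eq_quad_sum[OF rule, where F = "\<lambda>j r. g (X r) * \<kappa> r * (P j \<bullet> perp (Y r))"])
    fix j r assume j: "j \<in> {1..J}" and r: "r \<in> interior (element J j)"
    \<comment> \<open>\<open>len_g\<close> supplies a second factor \<open>sqrt g\<close>, which
      completes \<open>g\<close>, and a length that cancels the one in the unit normal.\<close>
    define c where "c = sqrt (g (X r))"
    have c: "g (X r) = c * c" using g_pos[OF XH] by (simp add: c_def less_imp_le)
    show "(sqrt (g (X r)) * \<kappa> r) *\<^sub>R nu X r \<bullet> len_g g X r *\<^sub>R Y r = g (X r) * \<kappa> r * (P j \<bullet> perp (Y r))"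
      unfolding interior_values[OF j r] c_def[symmetric] unfolding c
      using P0[OF j] by (simp add: perp_scaleR inner_perp)
  qed (auto intro!: cont')
  have 2: "quad_ip J K w \<alpha> (ds X X) (\<lambda>r. len_g g X r *\<^sub>R ds X Y r) =
      quad_sum J K w (\<lambda>j k. sqrt (g (X (pt j k))) * (P j \<bullet> slope J j Y) / norm (P j))"
    unfolding quad_ip_def
  proof (rule quad_eq_quad_sum[OF rule, where F = "\<lambda>j r. sqrt (g (X r)) * (P j \<bullet> slope J j Y) / norm (P j)"])
    fix j r assume j: "j \<in> {1..J}" and r: "r \<in> interior (element J j)"
    show "ds X X r \<bullet> len_g g X r *\<^sub>R ds X Y r = sqrt (g (X r)) * (P j \<bullet> slope J j Y) / norm (P j)"
      using P0[OF j] by (simp add: interior_values[OF j r] Y divide_inverse)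
  qed (auto intro!: cont' simp: P0)
  have 3: "quad_ip J K w \<alpha> (\<lambda>r. G (X r)) (\<lambda>r. len_g g X r *\<^sub>R Y r) =
      quad_sum J K w (\<lambda>j k. sqrt (g (X (pt j k))) * norm (P j) * (G (X (pt j k)) \<bullet> Y (pt j k)))"
    unfolding quad_ip_def
    by (rule quad_eq_quad_sum[OF rule, where F = "\<lambda>j r. sqrt (g (X r)) * norm (P j) * (G (X r) \<bullet> Y r)"])
      (auto intro!: cont' simp: interior_values)
  have "Y \<in> VVh J" using Y J by (simp add: VVh_iff_pw_affine)
  from assms[unfolded scheme_iii_def, THEN bspec, OF this]
  show ?thesis
    unfolding curvature_form_def quad_sum_add quad_sum_mult 1 2 3 .
qed

text \<open>The term with \<^const>\<open>omega\<close> is left as it is: both sides of the energy identity contain the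
  same function, so neither the existence of \<^const>\<open>omega\<close> nor its one-sided limits matter.\<close>

lemma scheme_i_quad_sum:
  assumes scheme: "scheme_i J K w \<alpha> g lam X V \<kappa> Y" and V: "pw_affine J V"
  defines "\<tau> \<equiv> \<lambda>j. tangent j" and "Q \<equiv> \<lambda>j. inverse (norm (P j)) *\<^sub>R slope J j V"
    and "Z \<equiv> \<lambda>j. inverse (norm (P j)) *\<^sub>R slope J j Y"
  defines "\<nu> \<equiv> \<lambda>j. - perp (\<tau> j)" and "l \<equiv> \<lambda>j r. sqrt (g (X r)) * norm (P j)"
  shows "quad_ip J K w \<alpha> (\<lambda>r. g (X r) * (V r \<bullet> omega J X r)\<^sup>2) (len_g g X) =
    quad_sum J K w (\<lambda>j k. let r = pt j k in
      (Z j \<bullet> \<nu> j) * ((Q j \<bullet> \<nu> j) * l j r)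
      + (- (1/2) * (((\<kappa> r)\<^sup>2 + 2 * lam - Y r \<bullet> G (X r)) * ((Q j \<bullet> \<tau> j + 1/2 * (V r \<bullet> G (X r))) * l j r))
      + 1/2 * ((D2 (X r) *v Y r) \<bullet> (l j r *\<^sub>R V r))
      + (sqrt (g (X r)) * \<kappa> r) * ((Q j \<bullet> perp (Y r)) * l j r)
      + (sqrt (g (X r)) * \<kappa> r * (Y r \<bullet> \<nu> j) + 1/2 * (Z j \<bullet> \<tau> j)) * ((V r \<bullet> G (X r)) * l j r)))"
proof -
  note defs = \<tau>_def Q_def Z_def \<nu>_def l_def
  note vals = interior_values interior_values(4)[OF _ _ V] interior_values(4)[OF _ _ Y]
  have omega: "quad_ip J K w \<alpha> (\<lambda>r. g (X r) * (V r \<bullet> omega J X r)\<^sup>2) (len_g g X) =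
      quad_ip J K w \<alpha> (\<lambda>r. g (X r) * (V r \<bullet> omega J X r)) (\<lambda>r. (V r \<bullet> omega J X r) * len_g g X r)"
    unfolding quad_ip_def by (simp add: power2_eq_square mult.assoc)
  have 1: "quad_ip J K w \<alpha> (\<lambda>r. ds X Y r \<bullet> nu X r) (\<lambda>r. (ds X V r \<bullet> nu X r) * len_g g X r) =
      quad_sum J K w (\<lambda>j k. (\<lambda>j r. (Z j \<bullet> \<nu> j) * ((Q j \<bullet> \<nu> j) * l j r)) j (pt j k))"
    unfolding quad_ip_def defs
    by (rule quad_eq_quad_sum[OF rule]) (auto intro!: cont' continuous_element[OF V] simp: vals)
  have 2: "quad_ip J K w \<alpha> (\<lambda>r. (\<kappa> r)\<^sup>2 + 2 * lam - Y r \<bullet> G (X r))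
        (\<lambda>r. (ds X V r \<bullet> tau X r + 1/2 * (V r \<bullet> G (X r))) * len_g g X r) =
      quad_sum J K w (\<lambda>j k. (\<lambda>j r. ((\<kappa> r)\<^sup>2 + 2 * lam - Y r \<bullet> G (X r)) *
        ((Q j \<bullet> \<tau> j + 1/2 * (V r \<bullet> G (X r))) * l j r)) j (pt j k))"
    unfolding quad_ip_def defs
    by (rule quad_eq_quad_sum[OF rule]) (auto intro!: cont' continuous_element[OF V] simp: vals)
  have 3: "quad_ip J K w \<alpha> (\<lambda>r. D2 (X r) *v Y r) (\<lambda>r. len_g g X r *\<^sub>R V r) =
      quad_sum J K w (\<lambda>j k. (\<lambda>j r. (D2 (X r) *v Y r) \<bullet> (l j r *\<^sub>R V r)) j (pt j k))"
    unfolding quad_ip_def defs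
    by (rule quad_eq_quad_sum[OF rule]) (auto intro!: cont' continuous_element[OF V] simp: vals)
  have 4: "quad_ip J K w \<alpha> (\<lambda>r. sqrt (g (X r)) * \<kappa> r) (\<lambda>r. (ds X V r \<bullet> perp (Y r)) * len_g g X r) =
      quad_sum J K w (\<lambda>j k. (\<lambda>j r. (sqrt (g (X r)) * \<kappa> r) * ((Q j \<bullet> perp (Y r)) * l j r)) j (pt j k))"
    unfolding quad_ip_def defs
    by (rule quad_eq_quad_sum[OF rule]) (auto intro!: cont' continuous_element[OF V] simp: vals)
  have 5: "quad_ip J K w \<alpha> (\<lambda>r. sqrt (g (X r)) * \<kappa> r * (Y r \<bullet> nu X r) + 1/2 * (ds X Y r \<bullet> tau X r))
        (\<lambda>r. (V r \<bullet> G (X r)) * len_g g X r) =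
      quad_sum J K w (\<lambda>j k. (\<lambda>j r. (sqrt (g (X r)) * \<kappa> r * (Y r \<bullet> \<nu> j) + 1/2 * (Z j \<bullet> \<tau> j)) *
        ((V r \<bullet> G (X r)) * l j r)) j (pt j k))"
    unfolding quad_ip_def defs
    by (rule quad_eq_quad_sum[OF rule]) (auto intro!: cont' continuous_element[OF V] simp: vals)
  have "V \<in> VVh J" using V J by (simp add: VVh_iff_pw_affine)
  from scheme[unfolded scheme_i_def Let_def, THEN bspec, OF this]
  show ?thesis
    unfolding omega Let_def quad_sum_add quad_sum_mult 1 2 3 4 5 by linarith
qed

end
end

section \<open>Differentiation in time and conclusion\<close>

lemma energy_identity_at:
  assumes J: "J > 0" and rule: "quadrature_rule K w \<alpha>"
    and sol: "scheme_solution J K w \<alpha> g lam T X \<kappa> Y"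
    and dX: "differentiable_in_time T X" and d\<kappa>: "differentiable_in_time T \<kappa>"
    and XH: "\<And>s r. s \<in> {0<..<T} \<Longrightarrow> X s r \<in> H"
    and t: "t \<in> {0<..<T}" and nondeg: "nondegenerate J (X t)"
  shows "energy_identity J K w \<alpha> g lam T X \<kappa> t"
proof -
  let ?pt = "quad_point J \<alpha>" and ?P = "\<lambda>s j. slope J j (X s)"
  let ?Xt = "dt T X t" and ?\<kappa>t = "dt T \<kappa> t"
  have X: "pw_affine J (X s)" and \<kappa>: "pw_affine J (\<kappa> s)" and Y: "pw_affine J (Y s)"
    and scheme: "nondegenerate J (X s) \<Longrightarrow> scheme_i J K w \<alpha> g lam (X s) (dt T X s) (\<kappa> s) (Y s) \<and>
      scheme_ii J K w \<alpha> g (X s) (\<kappa> s) (Y s) \<and> scheme_iii J K w \<alpha> g (X s) (\<kappa> s)"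
    if "s \<in> {0<..<T}" for s
    using sol that J by (auto simp: scheme_solution_def Vh_iff_pw_affine VVh_iff_pw_affine)
  have Xt: "pw_affine J ?Xt" using dX t X by (rule pw_affine_dt)
  have \<kappa>t: "pw_affine J ?\<kappa>t" using d\<kappa> t \<kappa> by (rule pw_affine_dt)
  have P0: "?P t j \<noteq> 0" if "j \<in> {1..J}" for j
    using nondeg nondegenerate_iff_slope[OF X[OF t]] that by blast
  note d = dt_has_vector_derivative[OF dX t] XH[OF t]
    dt_has_vector_derivative[OF d\<kappa> t, unfolded has_real_derivative_iff_has_vector_derivative[symmetric]]
    slope_dt[OF dX t] P0
  define E where "E s = quad_sum J K w (\<lambda>j k. energy_density lam (X s (?pt j k)) (\<kappa> s (?pt j k)) (?P s j))" for s
  define E' where "E' = quad_sum J K w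
    (\<lambda>j k. energy_density_deriv lam (X t (?pt j k)) (\<kappa> t (?pt j k)) (?P t j) (?Xt (?pt j k)) (?\<kappa>t (?pt j k)) (slope J j ?Xt))"
  have "(E has_real_derivative E') (at t)"
    unfolding E_def E'_def by (intro DERIV_quad_sum DERIV_energy_density d) auto
  from has_field_derivative_transform_within_open[OF this open_greaterThanLessThan t]
  have energy: "((\<lambda>s. energy J K w \<alpha> g lam (X s) (\<kappa> s)) has_real_derivative E') (at t)"
    unfolding E_def using energy_eq_quad_sum[OF J rule X XH \<kappa>] by simp
  \<comment> \<open>The left-hand side of scheme (iii) at time \<open>s\<close>, tested with
    \<open>Y\<close> frozen at time \<open>t\<close>.\<close>
  define C where "C s = quad_sum J K w
    (\<lambda>j k. curvature_form (X s (?pt j k)) (\<kappa> s (?pt j k)) (?P s j) (Y t (?pt j k)) (slope J j (Y t)))" for s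
  define C' where "C' = quad_sum J K w (\<lambda>j k. curvature_form_deriv (X t (?pt j k)) (\<kappa> t (?pt j k)) (?P t j)
    (Y t (?pt j k)) (slope J j (Y t)) (?Xt (?pt j k)) (?\<kappa>t (?pt j k)) (slope J j ?Xt))"
  have C: "(C has_real_derivative C') (at t)"
    unfolding C_def C'_def by (intro DERIV_quad_sum DERIV_curvature_form d) auto
  \<comment> \<open>Slopes are continuous in time at \<open>t\<close> and there are finitely many
    elements, so scheme (iii) holds throughout a neighbourhood of \<open>t\<close> and can be
    differentiated there.\<close>
  have "\<forall>\<^sub>F s in nhds t. ?P s j \<noteq> 0" if "j \<in> {1..J}" for j
    using tendsto_at_iff_tendsto_nhds[THEN iffD1, OF
        has_vector_derivative_continuous[OF slope_dt[OF dX t, of J j], unfolded isCont_def]] P0[OF that]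
    by (rule tendsto_imp_eventually_ne)
  then have "\<forall>\<^sub>F s in nhds t. \<forall>j\<in>{1..J}. ?P s j \<noteq> 0"
    by (simp add: eventually_ball_finite_distrib)
  moreover have "\<forall>\<^sub>F s in nhds t. s \<in> {0<..<T}"
    using t by (intro eventually_nhds_in_open) auto
  ultimately have "\<forall>\<^sub>F s in nhds t. C s = 0"
  proof eventually_elim
    case (elim s)
    then have "nondegenerate J (X s)" using nondegenerate_iff_slope[OF X] by blast
    then show ?case
      unfolding C_def using scheme elim X \<kappa> Y[OF t] XH
      by (intro scheme_iii_quad_sum[OF J rule]) auto
  qed
  then have "(C has_real_derivative 0) (at t)"
    by (subst DERIV_cong_ev[OF refl _ refl, where g = "\<lambda>_. 0"]) auto
  with C have C'0: "C' = 0" by (rule DERIV_unique)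
  note i = scheme_i_quad_sum[OF J rule X[OF t] XH[OF t] \<kappa>[OF t] Y[OF t] nondeg _ Xt]
    and ii = scheme_ii_quad_sum[OF J rule X[OF t] XH[OF t] \<kappa>[OF t] Y[OF t] nondeg _ \<kappa>t]
  \<comment> \<open>The summand 0 on the right is rewritten as the sum in scheme (ii) tested with
    \<open>\<kappa>\<^sub>t\<close>. Both sides then become single quadrature sums, compared term by
    term.\<close>
  have "quad_ip J K w \<alpha> (\<lambda>r. g (X t r) * (?Xt r \<bullet> omega J (X t) r)\<^sup>2) (len_g g (X t)) + 1/2 * E' = 0 + C'"
    unfolding E'_def C'_def ii[OF scheme[OF t nondeg, THEN conjunct2, THEN conjunct1], symmetric]
      i[OF scheme[OF t nondeg, THEN conjunct1]] quad_sum_mult[symmetric] quad_sum_add[symmetric] Let_def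
    by (intro quad_sum_cong pointwise_identity XH[OF t] P0)
  then show ?thesis
    using energy C'0 unfolding energy_identity_def
    by (auto simp: DERIV_imp_deriv field_differentiable_def)
qed

end

theorem theorem4p4:
  fixes H :: "(real^2) set" and g :: "real^2 \<Rightarrow> real"
    and J K :: nat and w \<alpha> :: "nat \<Rightarrow> real"
    and lam T :: real
    and X Y :: "real \<Rightarrow> real \<Rightarrow> real^2" and \<kappa> :: "real \<Rightarrow> real \<Rightarrow> real"
  assumes "open H" and "\<forall>x\<in>H. g x > 0" and "smooth_on g H"
    and "J \<ge> 3" and "quadrature_rule K w \<alpha>"
    and "T > 0"
    and "scheme_solution J K w \<alpha> g lam T X \<kappa> Y"
    and "differentiable_in_time T X" and "differentiable_in_time T \<kappa>"
    and "\<forall>t\<in>{0..T}. \<forall>r. X t r \<in> H"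
    and "AE p in lborel. p \<in> {0..1} \<times> {0<..<T} \<longrightarrow> len (X (snd p)) (fst p) > 0"
  shows "(\<forall>t\<in>{0<..<T}. nondegenerate J (X t) \<longrightarrow> energy_identity J K w \<alpha> g lam T X \<kappa> t) \<and>
         (AE t in lborel. t \<in> {0<..<T} \<longrightarrow>
            nondegenerate J (X t) \<and> energy_identity J K w \<alpha> g lam T X \<kappa> t)"
proof -
  interpret metric H g using assms(1-3) by unfold_locales auto
  have J: "J > 0" using assms(4) by simp
  have identity: "energy_identity J K w \<alpha> g lam T X \<kappa> t" if "t \<in> {0<..<T}" "nondegenerate J (X t)" for t
    using assms(10) that by (intro energy_identity_at[OF J assms(5,7,8,9)]) auto
  have "pw_affine J (X t)" if "t \<in> {0<..<T}" for t
    using assms(7) that J by (auto simp: scheme_solution_def VVh_iff_pw_affine)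
  then have "AE t in lborel. t \<in> {0<..<T} \<longrightarrow> nondegenerate J (X t)"
    using assms(11) by (rule nondegenerate_AE)
  then have "AE t in lborel. t \<in> {0<..<T} \<longrightarrow>
      nondegenerate J (X t) \<and> energy_identity J K w \<alpha> g lam T X \<kappa> t"
    by eventually_elim (use identity in blast)
  with identity show ?thesis by blast
qed

end
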